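(* Let $G$ be the connected $(3+1)$-dimensional Carroll group and $\mathfrak{g}^*\cong\mathbb{R}^3\times\mathbb{R}^3\times\mathbb{R}^3\times\mathbb{R}$ the dual of its Lie algebra, with elements written $\alpha=(\boldsymbol{j},\boldsymbol{k},\boldsymbol{p},E)$. Fix a unit vector $\boldsymbol{u}\in\mathbb{R}^3$ and a unit vector $\boldsymbol{u}_\perp\in\mathbb{R}^3$ perpendicular to $\boldsymbol{u}$. Then every coadjoint orbit of $G$ on $\mathfrak{g}^*$ is exactly one of the following, where for each allowed choice of parameters the displayed equations cut out in $\mathfrak{g}^*$ precisely one coadjoint orbit, which contains the indicated representative and has the indicated dimension: (1) (parameter $E_0\neq 0$) $E=E_0$, $E_0\boldsymbol{j}+\boldsymbol{p}\times\boldsymbol{k}=\boldsymbol{0}$; representative $(\boldsymbol{0},\boldsymbol{0},\boldsymbol{0},E_0)$; dimension $6$. (2) (parameters $E_0\neq 0$, $S>0$) $E=E_0$, $\|\boldsymbol{j}+E_0^{-1}\boldsymbol{p}\times\boldsymbol{k}\|=S$; representative $(S\boldsymbol{u},\boldsymbol{0},\boldsymbol{0},E_0)$; dimension $8$. (3) $E=0$, $\boldsymbol{p}=\boldsymbol{0}$, $\boldsymbol{k}=\boldsymbol{0}$, $\boldsymbol{j}=\boldsymbol{0}$; representative $(\boldsymbol{0},\boldsymbol{0},\boldsymbol{0},0)$; dimension $0$. (4) (parameter $j>0$) $E=0$, $\boldsymbol{p}=\boldsymbol{0}$, $\boldsymbol{k}=\boldsymbol{0}$, $\|\boldsymbol{j}\|=j$;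 representative $(j\boldsymbol{u},\boldsymbol{0},\boldsymbol{0},0)$; dimension $2$. (5) (parameters $k>0$, $h\in\mathbb{R}$) $E=0$, $\boldsymbol{p}=\boldsymbol{0}$, $\|\boldsymbol{k}\|=k$, $\boldsymbol{j}\cdot\boldsymbol{k}=h\|\boldsymbol{k}\|$; representative $(h\boldsymbol{u},k\boldsymbol{u},\boldsymbol{0},0)$; dimension $4$. (6) (parameters $p>0$, $h\in\mathbb{R}$) $E=0$, $\boldsymbol{k}=\boldsymbol{0}$, $\|\boldsymbol{p}\|=p$, $\boldsymbol{j}\cdot\boldsymbol{p}=h\|\boldsymbol{p}\|$; representative $(h\boldsymbol{u},\boldsymbol{0},p\boldsymbol{u},0)$; dimension $4$. ($7_\pm$) (parameters $p>0$, $k>0$, $h\in\mathbb{R}$ and a sign $\pm$) $E=0$, $\|\boldsymbol{p}\|=p$, $\|\boldsymbol{k}\|=k$, $\boldsymbol{p}\cdot\boldsymbol{k}=\pm pk$, $\boldsymbol{j}\cdot\boldsymbol{p}=h\|\boldsymbol{p}\|$; representative $(h\boldsymbol{u},\pm k\boldsymbol{u},p\boldsymbol{u},0)$; dimension $4$. (8) (parameters $p>0$, $k>0$, $\theta\in(0,\pi)$) $E=0$, $\|\boldsymbol{p}\|=p$, $\|\boldsymbol{k}\|=k$, $\boldsymbol{p}\cdot\boldsymbol{k}=pk\cos\theta$; representative $(\boldsymbol{0},k\cos\theta\,\boldsymbol{u}+k\sin\theta\,\boldsymbol{u}_\perp,p\boldsymbol{u},0)$; dimension $6$.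
   Context: The connected $(3+1)$-dimensional Carroll group $G$ is the $10$-dimensional subgroup of $\mathrm{GL}(5,\mathbb{R})$ of matrices (in $3+1+1$ block form) $$g(R,\boldsymbol{v},\boldsymbol{a},s)=\begin{pmatrix} R&\boldsymbol{0}&\boldsymbol{a}\\ \boldsymbol{v}^TR&1&s+\tfrac12\boldsymbol{v}^T\boldsymbol{a}\\ \boldsymbol{0}^T&0&1\end{pmatrix},\qquad R\in\mathrm{SO}(3),\ \boldsymbol{v},\boldsymbol{a}\in\mathbb{R}^3,\ s\in\mathbb{R}.$$ Its Lie algebra $\mathfrak{g}$ consists of the matrices $A=\begin{pmatrix}\varepsilon(\boldsymbol{w})&\boldsymbol{0}&\boldsymbol{y}\\ \boldsymbol{b}^T&0&c\\ \boldsymbol{0}^T&0&0\end{pmatrix}$ with $\boldsymbol{w},\boldsymbol{b},\boldsymbol{y}\in\mathbb{R}^3$, $c\in\mathbb{R}$, where $\varepsilon(\boldsymbol{w})\in\mathfrak{so}(3)$ is defined by $\varepsilon(\boldsymbol{w})\boldsymbol{x}=\boldsymbol{w}\times\boldsymbol{x}$. Elements of $\mathfrak{g}^*$ are written $\alpha=(\boldsymbol{j},\boldsymbol{k},\boldsymbol{p},E)$ with pairing $\langle\alpha,A\rangle=\boldsymbol{j}\cdot\boldsymbol{w}+\boldsymbol{k}\cdot\boldsymbol{b}+\boldsymbol{p}\cdot\boldsymbol{y}+Ec$. The coadjoint action is $\langle\mathrm{Ad}^*_g\alpha,A\rangle=\langle\alpha,\mathrm{Ad}_{g^{-1}}A\rangle$;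 explicitly, $\mathrm{Ad}^*_{g(R,\boldsymbol{v},\boldsymbol{a},s)}(\boldsymbol{j},\boldsymbol{k},\boldsymbol{p},E)=(\boldsymbol{j}',\boldsymbol{k}',\boldsymbol{p}',E')$ with $$\boldsymbol{j}'=R\boldsymbol{j}+\boldsymbol{v}\times R\boldsymbol{k}+\boldsymbol{a}\times R\boldsymbol{p}+E\,\boldsymbol{v}\times\boldsymbol{a},\quad \boldsymbol{k}'=R\boldsymbol{k}+E\boldsymbol{a},\quad \boldsymbol{p}'=R\boldsymbol{p}-E\boldsymbol{v},\quad E'=E.$$ *)

theory Defs
  imports "HOL-Analysis.Analysis"
begin

section \<open>The Carroll group and its Lie algebra\<close>

text \<open>
  5 by 5 matrices in 3+1+1 block form: an index is \<open>Inl i\<close>, \<open>Inr (Inl _)\<close> or \<open>Inr (Inr _)\<close>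
  for the three blocks. Below, \<open>block_mat M r y d c\<close> is the block matrix with rows
  \<open>(M, 0, y)\<close>, \<open>(r\<^sup>T, d, c)\<close>, \<open>(0, 0, d)\<close>.
\<close>

type_synonym mat311 = "real ^ (3 + 1 + 1) ^ (3 + 1 + 1)"

definition block_mat :: "real^3^3 \<Rightarrow> real^3 \<Rightarrow> real^3 \<Rightarrow> real \<Rightarrow> real \<Rightarrow> mat311" where
  "block_mat M r y d c = (\<chi> row col.
     (case row of
        Inl i \<Rightarrow> (case col of Inl l \<Rightarrow> M $ i $ l | Inr (Inl _) \<Rightarrow> 0 | Inr (Inr _) \<Rightarrow> y $ i)
      | Inr (Inl _) \<Rightarrow> (case col of Inl l \<Rightarrow> r $ l | Inr (Inl _) \<Rightarrow> d | Inr (Inr _) \<Rightarrow> c)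
      | Inr (Inr _) \<Rightarrow> (case col of Inl l \<Rightarrow> 0 | Inr (Inl _) \<Rightarrow> 0 | Inr (Inr _) \<Rightarrow> d)))"

definition carroll :: "real^3^3 \<Rightarrow> real^3 \<Rightarrow> real^3 \<Rightarrow> real \<Rightarrow> mat311" where
  "carroll R v a s = block_mat R (v v* R) a 1 (s + (v \<bullet> a) / 2)"

definition carroll_group :: "mat311 set" where
  "carroll_group = {carroll R v a s | R v a s. rotation_matrix R}"

definition eps :: "real^3 \<Rightarrow> real^3^3" where
  "eps w = matrix (\<lambda>x. cross3 w x)"

definition carroll_alg :: "real^3 \<Rightarrow> real^3 \<Rightarrow> real^3 \<Rightarrow> real \<Rightarrow> mat311" where
  "carroll_alg w b y c = block_mat (eps w) b y 0 c"

definition carroll_algebra :: "mat311 set" where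
  "carroll_algebra = {carroll_alg w b y c | w b y c. True}"


section \<open>The coadjoint action\<close>

text \<open>Elements \<open>(j, k, p, E)\<close> of the dual of the Lie algebra.\<close>

type_synonym carroll_dual = "(real^3) \<times> (real^3) \<times> (real^3) \<times> real"

definition pairing :: "carroll_dual \<Rightarrow> mat311 \<Rightarrow> real" where
  "pairing \<alpha> A = (case \<alpha> of (j, k, p, E) \<Rightarrow>
     THE r. \<exists>w b y c. A = carroll_alg w b y c \<and> r = j \<bullet> w + k \<bullet> b + p \<bullet> y + E * c)"

definition Ad :: "mat311 \<Rightarrow> mat311 \<Rightarrow> mat311" where
  "Ad g A = g ** A ** matrix_inv g"

definition coAd :: "mat311 \<Rightarrow> carroll_dual \<Rightarrow> carroll_dual" where
  "coAd g \<alpha> = (THE \<beta>. \<forall>A\<in>carroll_algebra. pairing \<beta> A = pairing \<alpha> (Ad (matrix_inv g) A))"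

definition coadjoint_orbit :: "carroll_dual \<Rightarrow> carroll_dual set" where
  "coadjoint_orbit \<alpha> = {coAd g \<alpha> | g. g \<in> carroll_group}"


subsection \<open>The explicit formula for the coadjoint action\<close>

lemma sum311: "(\<Sum>x\<in>(UNIV::(3+1+1) set). f x) = (\<Sum>i\<in>UNIV. f (Inl i)) + f (Inr (Inl 1)) + f (Inr (Inr (1::1)))" for f :: "3+1+1 \<Rightarrow> real"
  by (simp add: UNIV_Plus_UNIV[symmetric] sum.Plus del: UNIV_Plus_UNIV)

lemma block_mult: "block_mat M r y d c ** block_mat M' r' y' d' c'
  = block_mat (M ** M') (r v* M' + d *\<^sub>R r') (M *v y' + d' *\<^sub>R y) (d*d') (r \<bullet> y' + d*c' + c*d')"
  unfolding block_mat_def matrix_matrix_mult_def vec_eq_iff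
  by (auto simp: sum311 vector_matrix_mult_def matrix_vector_mult_def inner_vec_def algebra_simps split: sum.splits)

lemma block_one: "block_mat (mat 1) 0 0 1 0 = mat 1"
  unfolding block_mat_def mat_def vec_eq_iff by (auto simp: split: sum.splits)

lemma block_inj: "block_mat M r y d c = block_mat M' r' y' d' c' \<longleftrightarrow> M = M' \<and> r=r' \<and> y=y' \<and> d=d' \<and> c=c'"
proof
  assume a: "block_mat M r y d c = block_mat M' r' y' d' c'"
  have e: "block_mat M r y d c $ i $ l = block_mat M' r' y' d' c' $ i $ l" for i l using a by simp
  have 1: "M $ i $ l = M' $ i $ l" for i l using e[of "Inl i" "Inl l"] by (simp add: block_mat_def)
  have 2: "y $ i = y' $ i" for i using e[of "Inl i" "Inr (Inr 1)"] by (simp add: block_mat_def)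
  have 3: "r $ i = r' $ i" for i using e[of "Inr (Inl 1)" "Inl i"] by (simp add: block_mat_def)
  have 4: "d = d'" using e[of "Inr (Inl 1)" "Inr (Inl 1)"] by (simp add: block_mat_def)
  have 5: "c = c'" using e[of "Inr (Inl 1)" "Inr (Inr 1)"] by (simp add: block_mat_def)
  show "M = M' \<and> r=r' \<and> y=y' \<and> d=d' \<and> c=c'" using 1 2 3 4 5 by (simp add: vec_eq_iff)
qed simp

lemma eps_mult: "eps w *v x = cross3 w x"
proof -
  have "linear (cross3 w)" by (simp add: linear_iff cross_add_right cross_mult_right)
  then have "Vector_Spaces.linear (*s) (*s) (cross3 w)" by (simp add: linear_def scalar_mult_eq_scaleR[abs_def])
  then show ?thesis unfolding eps_def by (rule matrix_works)
qed

lemma mv_neg: "(A::real^'n^'m) *v (- x) = - (A *v x)" by (simp add: matrix_vector_mult_def vec_eq_iff sum_negf)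

lemma vm_neg: "(- x) v* (A::real^'n^'m) = - (x v* A)" by (simp add: vector_matrix_mult_def vec_eq_iff sum_negf)

lemma eps_inj: "eps w = eps w' \<Longrightarrow> w = w'"
proof -
  assume "eps w = eps w'"
  then have "\<And>x. cross3 w x = cross3 w' x" using eps_mult by metis
  from this[of "axis 1 1"] this[of "axis 2 1"] show "w = w'"
    by (auto simp: cross3_simps axis_def vec_eq_iff forall_3)
qed

lemma pairing_alg: "pairing (j,k,p,E) (carroll_alg w b y c) = j \<bullet> w + k \<bullet> b + p \<bullet> y + E * c"
  unfolding pairing_def carroll_alg_def by (auto simp: block_inj intro!: the_equality dest!: eps_inj)

lemma mat_inv_unique: fixes A B :: "real^'n^'n" assumes "A ** B = mat 1" "B ** A = mat 1" shows "matrix_inv A = B"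
  proof -
  have "\<exists>A'. A ** A' = mat 1 \<and> A' ** A = mat 1" using assms by blast
  from someI_ex[OF this] have "A ** matrix_inv A = mat 1 \<and> matrix_inv A ** A = mat 1" unfolding matrix_inv_def .
  then show ?thesis by (metis assms matrix_mul_assoc matrix_mul_lid matrix_mul_rid)
qed

lemma eps_conj: assumes "rotation_matrix R" shows "eps (R *v w) = R ** eps w ** transpose R"
proof -
  have "cross3 (R *v w) x = R *v cross3 w (transpose R *v x)" for x
    using assms cross_rotation_matrix[of R w "transpose R *v x"]
    by (simp add: matrix_vector_mul_assoc rotation_matrix_def orthogonal_matrix_def del: transpose_matrix_vector)
  then show ?thesis by (subst matrix_eq) (simp add: eps_mult matrix_vector_mul_assoc[symmetric])
qed

lemma coAd_formula:
  assumes R: "rotation_matrix R"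
  shows "coAd (carroll R v a s) (j,k,p,E) =
   (R *v j + cross3 v (R *v k) + cross3 a (R *v p) + E *\<^sub>R cross3 v a, R *v k + E *\<^sub>R a, R *v p - E *\<^sub>R v, E)"
proof -
  let ?g = "carroll R v a s" let ?T = "transpose R"
  let ?\<sigma> = "s + (v \<bullet> a) / 2"
  define h where "h = block_mat ?T (-v) (- (?T *v a)) 1 (v \<bullet> a - ?\<sigma>)"
  have o: "R ** ?T = mat 1" "?T ** R = mat 1" using R by (auto simp: rotation_matrix_def orthogonal_matrix_def)
  have a1: "R *v (?T *v x) = x" for x by (simp add: matrix_vector_mul_assoc o del: transpose_matrix_vector)
  have a2: "?T *v (R *v x) = x" for x by (simp add: matrix_vector_mul_assoc o del: transpose_matrix_vector)
  have vm: "x v* R = ?T *v x" "x v* ?T = R *v x" for x by simp_all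
  have ip: "(?T *v x) \<bullet> y = x \<bullet> (R *v y)" for x y
    by (metis dot_lmul_matrix vm(1))
  have gh: "?g ** h = mat 1"
    unfolding h_def carroll_def block_mult block_one[symmetric] block_inj
    by (simp add: o a1 mv_neg vm_neg del: transpose_matrix_vector) (simp add: vm ip a1 inner_simps inner_commute del: transpose_matrix_vector)
  have hg: "h ** ?g = mat 1" using gh matrix_left_right_inverse by blast
  have gi: "matrix_inv ?g = h" using mat_inv_unique[OF gh hg] .
  have hi: "matrix_inv h = ?g" using mat_inv_unique[OF hg gh] .
  let ?\<beta> = "(R *v j + cross3 v (R *v k) + cross3 a (R *v p) + E *\<^sub>R cross3 v a, R *v k + E *\<^sub>R a, R *v p - E *\<^sub>R v, E)"
  have ad: "Ad h (carroll_alg w b y c) = carroll_alg (?T *v w) (?T *v (b + cross3 w v)) (?T *v (cross3 w a + y)) (c + b \<bullet> a - v \<bullet> y - v \<bullet> cross3 w a)" for w b y c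
  proof -
    have rt: "rotation_matrix ?T" using R by (simp add: rotation_matrix_def)
    have e: "eps (?T *v w) = ?T ** eps w ** R" using eps_conj[OF rt] by simp
    have "v v* eps w = - cross3 w v"
    proof -
      have "(v v* eps w) \<bullet> x = - cross3 w v \<bullet> x" for x
        unfolding dot_lmul_matrix eps_mult by (simp add: cross3_simps)
      then show ?thesis by (metis vector_eq_rdot)
    qed
    then have v: "(- v) v* eps w = cross3 w v"
      by (simp add: vm_neg)
    show ?thesis
      unfolding Ad_def hi unfolding h_def carroll_def carroll_alg_def block_mult block_inj e
      by (auto simp: v eps_mult matrix_vector_mul_assoc[symmetric] inner_simps matrix_vector_right_distrib add_ac) (auto simp: cross3_simps)
  qed
  have e1: "pairing ?\<beta> A = pairing (j,k,p,E) (Ad (matrix_inv ?g) A)" if mem: "A \<in> carroll_algebra" for A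
  proof -
    obtain w b y c where A: "A = carroll_alg w b y c" using mem unfolding carroll_algebra_def by blast
    have ipr: "x \<bullet> (?T *v y) = (R *v x) \<bullet> y" for x y using ip[of y x] by (simp add: inner_commute)
    show ?thesis unfolding gi A ad pairing_alg ipr
      by (simp add: cross3_simps) 
  qed
  have e2: "\<beta> = ?\<beta>" if "\<forall>A\<in>carroll_algebra. pairing \<beta> A = pairing (j,k,p,E) (Ad (matrix_inv ?g) A)" for \<beta>
  proof -
    obtain j1 k1 p1 E1 where b: "\<beta> = (j1,k1,p1,E1)" by (cases \<beta>) auto
    obtain j2 k2 p2 E2 where b2: "?\<beta> = (j2,k2,p2,E2)" by auto
    have q: "j1 \<bullet> w + k1 \<bullet> b + p1 \<bullet> y + E1 * c = j2 \<bullet> w + k2 \<bullet> b + p2 \<bullet> y + E2 * c" for w b y c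
    proof -
      have m: "carroll_alg w b y c \<in> carroll_algebra" by (auto simp: carroll_algebra_def)
      show ?thesis using that[rule_format, OF m] e1[OF m] unfolding b b2 pairing_alg by simp
    qed
    have "j1 = j2" using q[of _ 0 0 0] by simp (metis vector_eq_rdot)
    moreover have "k1 = k2" using q[of 0 _ 0 0] by simp (metis vector_eq_rdot)
    moreover have "p1 = p2" using q[of 0 0 _ 0] by simp (metis vector_eq_rdot)
    moreover have "E1 = E2" using q[of 0 0 0 1] by simp
    ultimately show ?thesis unfolding b b2 by simp
  qed
  show ?thesis unfolding coAd_def using e1 e2 by (intro the_equality) blast+
qed


section \<open>Dimension of a smooth submanifold\<close>

text \<open>\<open>C\<^sup>k\<close> functions on an open set.\<close>

primrec Ck_on :: "nat \<Rightarrow> ('a::euclidean_space \<Rightarrow> 'b::euclidean_space) \<Rightarrow> 'a set \<Rightarrow> bool" where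
  "Ck_on 0 f U \<longleftrightarrow> continuous_on U f"
| "Ck_on (Suc n) f U \<longleftrightarrow>
     (\<exists>f'. (\<forall>x\<in>U. (f has_derivative f' x) (at x)) \<and> (\<forall>v. Ck_on n (\<lambda>x. f' x v) U))"

definition smooth_on :: "('a::euclidean_space \<Rightarrow> 'b::euclidean_space) \<Rightarrow> 'a set \<Rightarrow> bool" where
  "smooth_on f U \<longleftrightarrow> (\<forall>n. Ck_on n f U)"

text \<open>
  Embedded smooth submanifold of dimension \<open>d\<close>: around each point some diffeomorphism of open
  sets straightens \<open>S\<close> to a linear subspace of dimension \<open>d\<close>.
\<close>

definition submanifold_of_dim :: "nat \<Rightarrow> ('a::euclidean_space) set \<Rightarrow> bool" where
  "submanifold_of_dim d S \<longleftrightarrow>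
     (\<forall>x\<in>S. \<exists>U V (\<phi> :: 'a \<Rightarrow> 'a) \<psi> T.
        open U \<and> x \<in> U \<and> open V \<and> smooth_on \<phi> U \<and> smooth_on \<psi> V \<and> homeomorphism U V \<phi> \<psi> \<and>
        subspace T \<and> dim T = d \<and> \<phi> ` (S \<inter> U) = V \<inter> T)"


section \<open>The list of orbits\<close>

text \<open>
  One constructor per family, carrying the parameters of the family; the first argument of
  \<open>Type7\<close> is the sign, \<open>1\<close> or \<open>- 1\<close>.
\<close>

datatype orbit_type =
    Type1 real
  | Type2 real real
  | Type3
  | Type4 real
  | Type5 real real
  | Type6 real real
  | Type7 real real real real
  | Type8 real real real

primrec allowed :: "orbit_type \<Rightarrow> bool" where
  "allowed (Type1 E0) \<longleftrightarrow> E0 \<noteq> 0"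
| "allowed (Type2 E0 S) \<longleftrightarrow> E0 \<noteq> 0 \<and> S > 0"
| "allowed Type3 \<longleftrightarrow> True"
| "allowed (Type4 j0) \<longleftrightarrow> j0 > 0"
| "allowed (Type5 k0 h) \<longleftrightarrow> k0 > 0"
| "allowed (Type6 p0 h) \<longleftrightarrow> p0 > 0"
| "allowed (Type7 \<sigma> p0 k0 h) \<longleftrightarrow> \<sigma> \<in> {1, - 1} \<and> p0 > 0 \<and> k0 > 0"
| "allowed (Type8 p0 k0 \<theta>) \<longleftrightarrow> p0 > 0 \<and> k0 > 0 \<and> \<theta> \<in> {0<..<pi}"

primrec locus :: "orbit_type \<Rightarrow> carroll_dual set" where
  "locus (Type1 E0) = {(j, k, p, E). E = E0 \<and> E0 *\<^sub>R j + cross3 p k = 0}"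
| "locus (Type2 E0 S) = {(j, k, p, E). E = E0 \<and> norm (j + inverse E0 *\<^sub>R cross3 p k) = S}"
| "locus Type3 = {(j, k, p, E). E = 0 \<and> p = 0 \<and> k = 0 \<and> j = 0}"
| "locus (Type4 j0) = {(j, k, p, E). E = 0 \<and> p = 0 \<and> k = 0 \<and> norm j = j0}"
| "locus (Type5 k0 h) =
     {(j, k, p, E). E = 0 \<and> p = 0 \<and> norm k = k0 \<and> j \<bullet> k = h * norm k}"
| "locus (Type6 p0 h) =
     {(j, k, p, E). E = 0 \<and> k = 0 \<and> norm p = p0 \<and> j \<bullet> p = h * norm p}"
| "locus (Type7 \<sigma> p0 k0 h) =
     {(j, k, p, E). E = 0 \<and> norm p = p0 \<and> norm k = k0 \<and> p \<bullet> k = \<sigma> * (p0 * k0) \<and>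
        j \<bullet> p = h * norm p}"
| "locus (Type8 p0 k0 \<theta>) =
     {(j, k, p, E). E = 0 \<and> norm p = p0 \<and> norm k = k0 \<and> p \<bullet> k = p0 * k0 * cos \<theta>}"

primrec representative :: "real^3 \<Rightarrow> real^3 \<Rightarrow> orbit_type \<Rightarrow> carroll_dual" where
  "representative u u' (Type1 E0) = (0, 0, 0, E0)"
| "representative u u' (Type2 E0 S) = (S *\<^sub>R u, 0, 0, E0)"
| "representative u u' Type3 = (0, 0, 0, 0)"
| "representative u u' (Type4 j0) = (j0 *\<^sub>R u, 0, 0, 0)"
| "representative u u' (Type5 k0 h) = (h *\<^sub>R u, k0 *\<^sub>R u, 0, 0)"
| "representative u u' (Type6 p0 h) = (h *\<^sub>R u, 0, p0 *\<^sub>R u, 0)"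
| "representative u u' (Type7 \<sigma> p0 k0 h) = (h *\<^sub>R u, (\<sigma> * k0) *\<^sub>R u, p0 *\<^sub>R u, 0)"
| "representative u u' (Type8 p0 k0 \<theta>) =
     (0, (k0 * cos \<theta>) *\<^sub>R u + (k0 * sin \<theta>) *\<^sub>R u', p0 *\<^sub>R u, 0)"

primrec orbit_dim :: "orbit_type \<Rightarrow> nat" where
  "orbit_dim (Type1 E0) = 6"
| "orbit_dim (Type2 E0 S) = 8"
| "orbit_dim Type3 = 0"
| "orbit_dim (Type4 j0) = 2"
| "orbit_dim (Type5 k0 h) = 4"
| "orbit_dim (Type6 p0 h) = 4"
| "orbit_dim (Type7 \<sigma> p0 k0 h) = 4"
| "orbit_dim (Type8 p0 k0 \<theta>) = 6"

end

theory Submission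
  imports Defs
begin

text \<open>
  For \<open>E \<noteq> 0\<close> the translations \<open>v\<close> and \<open>a\<close> move \<open>p\<close> and \<open>k\<close> freely, and the spin \<open>E j + p \<times> k\<close>
  transforms by \<open>R\<close> alone, so its length is the only further invariant. For \<open>E = 0\<close> the pair
  \<open>(k, p)\<close> is merely rotated, while \<open>j\<close> can be shifted by any vector \<open>v \<times> k + a \<times> p\<close>: these are all
  vectors if \<open>k\<close> and \<open>p\<close> are independent, and the plane orthogonal to their common line if they are
  parallel and not both zero. Each orbit is the zero set of a polynomial map whose derivative is
  surjective along it; for type 7 the equations \<open>\<parallel>k\<parallel> = k0\<close> and \<open>p \<bullet> k = \<plusminus> p0 k0\<close>, which are not regular,
  are first replaced by \<open>k = \<plusminus> (k0 / p0) p\<close>.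
\<close>

section \<open>Smooth maps\<close>

text \<open>Openness of \<open>U\<close> makes agreement on \<open>U\<close> an agreement near each
  of its points, so the derivatives carry over as well.\<close>

lemma Ck_on_cong:
  assumes "open U" "\<And>x. x \<in> U \<Longrightarrow> f x = g x" "Ck_on n f U"
  shows "Ck_on n g U"
proof (cases n)
  case 0
  then show ?thesis
    using assms by (auto cong: continuous_on_cong)
next
  case (Suc m)
  then obtain f' where "\<forall>x\<in>U. (f has_derivative f' x) (at x)" "\<forall>v. Ck_on m (\<lambda>x. f' x v) U"
    using assms(3) by auto
  moreover have "(g has_derivative f' x) (at x)" if "x \<in> U" "(f has_derivative f' x) (at x)" for x
    using has_derivative_transform_within_open[OF that(2) assms(1) that(1)] assms(2) by auto
  ultimately show ?thesis
    unfolding Suc Ck_on.simps by blast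
qed

lemma Ck_on_subset: "Ck_on n f U \<Longrightarrow> V \<subseteq> U \<Longrightarrow> Ck_on n f V"
proof (induction n arbitrary: f)
  case (Suc n)
  then obtain f' where "\<forall>x\<in>U. (f has_derivative f' x) (at x)" "\<forall>v. Ck_on n (\<lambda>x. f' x v) U"
    by auto
  with Suc show ?case
    unfolding Ck_on.simps by blast
qed (auto intro: continuous_on_subset)

lemma Ck_on_Suc_imp: "Ck_on (Suc n) f U \<Longrightarrow> Ck_on n f U"
proof (induction n arbitrary: f)
  case 0
  then show ?case
    by (auto intro!: continuous_at_imp_continuous_on dest!: bspec has_derivative_continuous)
next
  case (Suc n)
  obtain f' where "\<forall>x\<in>U. (f has_derivative f' x) (at x)" "\<forall>v. Ck_on (Suc n) (\<lambda>x. f' x v) U"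
    using Suc.prems Ck_on.simps(2) by blast
  with Suc.IH show ?case
    unfolding Ck_on.simps(2)[of n] by blast
qed

lemma Ck_on_imp_continuous_on: "Ck_on n f U \<Longrightarrow> continuous_on U f"
  by (induction n) (auto dest: Ck_on_Suc_imp simp del: Ck_on.simps(2))

lemma Ck_on_const: "Ck_on n (\<lambda>x. c) U"
proof (induction n arbitrary: c)
  case (Suc n)
  have "\<forall>x\<in>U. ((\<lambda>x. c) has_derivative (\<lambda>v. 0)) (at x)"
    by simp
  with Suc[of 0] show ?case
    unfolding Ck_on.simps by (intro exI[of _ "\<lambda>x v. 0"]) auto
qed simp

lemma Ck_on_linear:
  assumes "bounded_linear L"
  shows "Ck_on n L U"
proof (cases n)
  case 0
  then show ?thesis
    using assms by (simp add: linear_continuous_on)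
next
  case (Suc m)
  show ?thesis
    unfolding Suc Ck_on.simps
    by (rule exI[of _ "\<lambda>x. L"]) (use assms in \<open>auto intro: bounded_linear_imp_has_derivative Ck_on_const\<close>)
qed

lemma Ck_on_add: "Ck_on n f U \<Longrightarrow> Ck_on n g U \<Longrightarrow> Ck_on n (\<lambda>x. f x + g x) U"
proof (induction n arbitrary: f g)
  case (Suc n)
  obtain f' where f': "\<forall>x\<in>U. (f has_derivative f' x) (at x)" "\<forall>v. Ck_on n (\<lambda>x. f' x v) U"
    using Suc.prems(1) by auto
  obtain g' where g': "\<forall>x\<in>U. (g has_derivative g' x) (at x)" "\<forall>v. Ck_on n (\<lambda>x. g' x v) U"
    using Suc.prems(2) by auto
  show ?case
    unfolding Ck_on.simps
    by (rule exI[of _ "\<lambda>x v. f' x v + g' x v"]) (use Suc.IH f' g' in \<open>auto intro: has_derivative_add\<close>)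
qed (auto intro: continuous_intros)

text \<open>The product rule, proved once for all bilinear operations; scaling, inner product and
  \<open>cross3\<close> are instances.\<close>

lemma Ck_on_bilinear:
  assumes "bounded_bilinear B"
  shows "Ck_on n f U \<Longrightarrow> Ck_on n g U \<Longrightarrow> Ck_on n (\<lambda>x. B (f x) (g x)) U"
proof (induction n arbitrary: f g)
  case 0
  then show ?case
    using bounded_bilinear.continuous_on[OF assms] by simp
next
  case (Suc n)
  obtain f' where f': "\<forall>x\<in>U. (f has_derivative f' x) (at x)" "\<forall>v. Ck_on n (\<lambda>x. f' x v) U"
    using Suc.prems(1) by auto
  obtain g' where g': "\<forall>x\<in>U. (g has_derivative g' x) (at x)" "\<forall>v. Ck_on n (\<lambda>x. g' x v) U"
    using Suc.prems(2) by auto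
  \<comment> \<open>The product rule keeps one factor undifferentiated in each term, so the
    induction hypothesis also needs \<open>f\<close> and \<open>g\<close> themselves at order
    \<open>n\<close>.\<close>
  have "Ck_on n f U" "Ck_on n g U"
    using Suc.prems by (auto intro: Ck_on_Suc_imp simp del: Ck_on.simps)
  then have "\<forall>v. Ck_on n (\<lambda>x. B (f x) (g' x v) + B (f' x v) (g x)) U"
    using Suc.IH f' g' by (auto intro: Ck_on_add)
  then show ?case
    unfolding Ck_on.simps
    by (intro exI[of _ "\<lambda>x v. B (f x) (g' x v) + B (f' x v) (g x)"])
      (use f' g' in \<open>auto intro: bounded_bilinear.FDERIV[OF assms]\<close>)
qed

lemma Ck_on_scaleR:
  "Ck_on n f U \<Longrightarrow> Ck_on n g U \<Longrightarrow> Ck_on n (\<lambda>x. f x *\<^sub>R g x) U"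
  by (rule Ck_on_bilinear[OF bounded_bilinear_scaleR])

lemma Ck_on_inner:
  "Ck_on n f U \<Longrightarrow> Ck_on n g U \<Longrightarrow> Ck_on n (\<lambda>x. f x \<bullet> g x) U"
  by (rule Ck_on_bilinear[OF bounded_bilinear_inner])

lemma Ck_on_sum: "(\<And>i. i \<in> I \<Longrightarrow> Ck_on n (f i) U) \<Longrightarrow> Ck_on n (\<lambda>x. \<Sum>i\<in>I. f i x) U"
  by (induction I rule: infinite_finite_induct) (auto intro: Ck_on_add Ck_on_const)

text \<open>\<open>Ck_on\<close> controls a derivative only in fixed directions; this expansion
  reduces a direction that varies with the point to the fixed basis directions.\<close>

lemma linear_expand:
  fixes L :: "'a::euclidean_space \<Rightarrow> 'b::real_normed_vector"
  assumes "linear L"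
  shows "L x = (\<Sum>b\<in>Basis. (x \<bullet> b) *\<^sub>R L b)"
proof -
  have "L x = L (\<Sum>b\<in>Basis. (x \<bullet> b) *\<^sub>R b)"
    by (simp add: euclidean_representation)
  also have "\<dots> = (\<Sum>b\<in>Basis. (x \<bullet> b) *\<^sub>R L b)"
    using assms by (simp add: linear_sum linear_scale o_def)
  finally show ?thesis .
qed

lemma Ck_on_compose:
  fixes f :: "'a::euclidean_space \<Rightarrow> 'b::euclidean_space" and g :: "'b \<Rightarrow> 'c::euclidean_space"
  shows "open U \<Longrightarrow> Ck_on n f U \<Longrightarrow> Ck_on n g W \<Longrightarrow> f ` U \<subseteq> W \<Longrightarrow> Ck_on n (\<lambda>x. g (f x)) U"
proof (induction n arbitrary: g)
  case 0
  then show ?case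
    by (auto intro: continuous_on_compose2)
next
  case (Suc n)
  obtain f' where f': "\<forall>x\<in>U. (f has_derivative f' x) (at x)" "\<forall>v. Ck_on n (\<lambda>x. f' x v) U"
    using Suc.prems by auto
  obtain g' where g': "\<forall>x\<in>W. (g has_derivative g' x) (at x)" "\<forall>v. Ck_on n (\<lambda>x. g' x v) W"
    using Suc.prems by auto
  have lower: "Ck_on n f U"
    using Suc.prems by (auto intro: Ck_on_Suc_imp simp del: Ck_on.simps)
  \<comment> \<open>In the chain rule the direction \<open>f' x v\<close> moves with
    \<open>x\<close>. Expanded in the basis, the expression becomes a sum of products to which the
    induction hypothesis applies.\<close>
  have "Ck_on n (\<lambda>x. g' (f x) (f' x v)) U" for v
  proof (rule Ck_on_cong)
    show "Ck_on n (\<lambda>x. \<Sum>b\<in>Basis. (f' x v \<bullet> b) *\<^sub>R g' (f x) b) U"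
      using lower f' g' Suc by (intro Ck_on_sum Ck_on_scaleR Ck_on_inner Ck_on_const Suc.IH) auto
    show "(\<Sum>b\<in>Basis. (f' x v \<bullet> b) *\<^sub>R g' (f x) b) = g' (f x) (f' x v)" if "x \<in> U" for x
      using that Suc.prems g' by (subst linear_expand[of "g' (f x)" "f' x v"])
        (auto intro: has_derivative_linear)
  qed (use Suc.prems in auto)
  moreover have "\<forall>x\<in>U. ((\<lambda>x. g (f x)) has_derivative (\<lambda>v. g' (f x) (f' x v))) (at x)"
    using f' g' Suc.prems by (auto intro!: has_derivative_compose[of f _ _ UNIV g])
  ultimately show ?case
    unfolding Ck_on.simps by (intro exI[of _ "\<lambda>x v. g' (f x) (f' x v)"]) auto
qed

lemma Ck_on_Pair:
  "Ck_on n f U \<Longrightarrow> Ck_on n g U \<Longrightarrow> Ck_on n (\<lambda>x. (f x, g x)) U"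
proof (induction n arbitrary: f g)
  case 0
  then show ?case
    by (auto intro: continuous_intros)
next
  case (Suc n)
  obtain f' where f': "\<forall>x\<in>U. (f has_derivative f' x) (at x)" "\<forall>v. Ck_on n (\<lambda>x. f' x v) U"
    using Suc.prems(1) by auto
  obtain g' where g': "\<forall>x\<in>U. (g has_derivative g' x) (at x)" "\<forall>v. Ck_on n (\<lambda>x. g' x v) U"
    using Suc.prems(2) by auto
  show ?case
    unfolding Ck_on.simps
    by (rule exI[of _ "\<lambda>x v. (f' x v, g' x v)"]) (use Suc.IH f' g' in \<open>auto intro: has_derivative_Pair\<close>)
qed

text \<open>Where \<open>f\<close> vanishes, the term containing the derivative of \<open>g\<close>
  drops out of the product rule, so continuity of \<open>g\<close> is enough. This allows
  differentiating an inverse that is so far only known to be continuous.\<close>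

lemma has_derivative_scaleR_vanishing:
  fixes f :: "'a::euclidean_space \<Rightarrow> real" and g :: "'a \<Rightarrow> 'b::real_normed_vector"
  assumes f: "(f has_derivative f') (at x)" and "f x = 0" and g: "continuous (at x) g"
  shows "((\<lambda>y. f y *\<^sub>R g y) has_derivative (\<lambda>h. f' h *\<^sub>R g x)) (at x)"
proof -
  have bl: "bounded_linear f'"
    using f has_derivative_bounded_linear by blast
  obtain K where K: "\<And>h. norm (f' h) \<le> norm h * K"
    using bounded_linear.bounded[OF bl] by blast
  have lim_f: "((\<lambda>y. (f y - f x - f' (y - x)) /\<^sub>R norm (y - x)) \<longlongrightarrow> 0) (at x)"
    using f unfolding has_derivative_at_within by auto
  have lim_g: "(g \<longlongrightarrow> g x) (at x)"
    using g by (simp add: continuous_within)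
  have lim2: "((\<lambda>y. (f' (y - x) / norm (y - x)) *\<^sub>R (g y - g x)) \<longlongrightarrow> 0) (at x)"
  proof (rule Lim_null_comparison)
    show "\<forall>\<^sub>F y in at x. norm ((f' (y - x) / norm (y - x)) *\<^sub>R (g y - g x)) \<le> \<bar>K\<bar> * norm (g y - g x)"
    proof (rule always_eventually, rule allI)
      fix y
      have "\<bar>f' (y - x)\<bar> \<le> norm (y - x) * \<bar>K\<bar>"
        using K[of "y - x"] by (smt (verit) mult_left_mono norm_ge_zero real_norm_def)
      then have "\<bar>f' (y - x) / norm (y - x)\<bar> \<le> \<bar>K\<bar>"
        by (cases "y = x") (auto simp: abs_divide divide_le_eq mult.commute)
      then show "norm ((f' (y - x) / norm (y - x)) *\<^sub>R (g y - g x)) \<le> \<bar>K\<bar> * norm (g y - g x)"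
        by (metis mult_right_mono norm_ge_zero norm_scaleR)
    qed
    have "((\<lambda>y. \<bar>K\<bar> * norm (g y - g x)) \<longlongrightarrow> \<bar>K\<bar> * norm (g x - g x)) (at x)"
      by (intro tendsto_intros lim_g)
    then show "((\<lambda>y. \<bar>K\<bar> * norm (g y - g x)) \<longlongrightarrow> 0) (at x)"
      by simp
  qed
  \<comment> \<open>The remainder splits into the linearisation error of \<open>f\<close> times
    \<open>g y\<close>, plus the linear part of \<open>f\<close> times the increment of
    \<open>g\<close>.\<close>
  have "((\<lambda>y. ((f y - f x - f' (y - x)) /\<^sub>R norm (y - x)) *\<^sub>R g y
      + (f' (y - x) / norm (y - x)) *\<^sub>R (g y - g x)) \<longlongrightarrow> 0 *\<^sub>R g x + 0) (at x)"
    by (intro tendsto_add tendsto_scaleR lim_f lim_g lim2)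
  moreover have "((f y - f x - f' (y - x)) /\<^sub>R norm (y - x)) *\<^sub>R g y
      + (f' (y - x) / norm (y - x)) *\<^sub>R (g y - g x)
      = (f y *\<^sub>R g y - f x *\<^sub>R g x - f' (y - x) *\<^sub>R g x) /\<^sub>R norm (y - x)" for y
    by (simp add: \<open>f x = 0\<close> algebra_simps divide_inverse)
  ultimately have "((\<lambda>y. (f y *\<^sub>R g y - f x *\<^sub>R g x - f' (y - x) *\<^sub>R g x) /\<^sub>R norm (y - x)) \<longlongrightarrow> 0) (at x)"
    by simp
  moreover have "bounded_linear (\<lambda>h. f' h *\<^sub>R g x)"
    using bl by (rule bounded_linear_scaleR_const)
  ultimately show ?thesis
    unfolding has_derivative_at_within by simp
qed

subsection \<open>The inverse of a smooth family of linear automorphisms\<close>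

lemma inv_linear_bij:
  fixes L :: "'a::euclidean_space \<Rightarrow> 'a"
  assumes "linear L" "bij L"
  shows "linear (inv L)"
  using assms by (metis bij_is_inj inj_linear_imp_inv_linear)

text \<open>An injective linear map is bounded below by some \<open>m > 0\<close>. Nearby maps keep
  the lower bound \<open>m - d y\<close>, and this controls the distance between the two solutions
  of the linear equation with right-hand side \<open>v\<close>.\<close>

lemma continuous_on_inv_linear:
  fixes A :: "'c::euclidean_space \<Rightarrow> 'a::euclidean_space \<Rightarrow> 'a"
  assumes V: "open V"
    and lin: "\<And>y. y \<in> V \<Longrightarrow> linear (A y)" and bij: "\<And>y. y \<in> V \<Longrightarrow> bij (A y)"
    and cont: "\<And>w. continuous_on V (\<lambda>y. A y w)"
  shows "continuous_on V (\<lambda>y. inv (A y) v)"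
proof (rule continuous_at_imp_continuous_on, rule ballI)
  fix x assume x: "x \<in> V"
  have lim: "((\<lambda>y. A y w) \<longlongrightarrow> A x w) (at x)" for w
    using cont[of w] x V by (simp add: continuous_on_eq_continuous_at continuous_within)
  obtain m where m: "m > 0" "\<And>w. m * norm w \<le> norm (A x w)"
    using linear_inj_bounded_below_pos[OF lin[OF x] bij_is_inj[OF bij[OF x]]] by metis
  define w0 where "w0 = inv (A x) v"
  \<comment> \<open>This sum bounds the operator norm of \<open>A y - A x\<close>, because no
    coordinate of a vector exceeds its norm.\<close>
  define d where "d y = (\<Sum>b\<in>Basis. norm (A y b - A x b))" for y
  have "(d \<longlongrightarrow> (\<Sum>b\<in>(Basis::'a set). norm (A x b - A x b))) (at x)"
    unfolding d_def by (intro tendsto_intros lim)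
  then have lim_d: "(d \<longlongrightarrow> 0) (at x)"
    by simp
  have ev_d: "\<forall>\<^sub>F y in at x. d y < m"
    using order_tendstoD(2)[OF lim_d m(1)] .
  have ev_V: "\<forall>\<^sub>F y in at x. y \<in> V"
    using V x by (rule eventually_at_in_open')
  have bound: "norm (inv (A y) v - w0) \<le> norm (v - A y w0) / (m - d y)" if y: "y \<in> V" "d y < m" for y
  proof -
    define r where "r = inv (A y) v - w0"
    have "A y r = v - A y w0"
      unfolding r_def using lin[OF y(1)] bij[OF y(1)]
      by (simp add: linear_diff bij_is_surj surj_f_inv_f)
    have "A y r - A x r = (\<Sum>b\<in>Basis. (r \<bullet> b) *\<^sub>R (A y b - A x b))"
      by (simp add: linear_expand[OF lin[OF y(1)], of r] linear_expand[OF lin[OF x], of r]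
          scaleR_diff_right sum_subtractf)
    also have "norm \<dots> \<le> (\<Sum>b\<in>(Basis::'a set). norm r * norm (A y b - A x b))"
      by (rule sum_norm_le) (auto intro!: mult_right_mono Basis_le_norm)
    also have "\<dots> = norm r * d y"
      by (simp add: d_def sum_distrib_left)
    finally have "norm (A x r) - norm r * d y \<le> norm (A y r)"
      by (smt (verit) norm_minus_commute norm_triangle_ineq2)
    with m(2)[of r] have "norm r * (m - d y) \<le> norm (v - A y w0)"
      unfolding \<open>A y r = v - A y w0\<close> by (simp add: algebra_simps)
    then show ?thesis
      unfolding r_def using y by (simp add: pos_le_divide_eq)
  qed
  have "((\<lambda>y. inv (A y) v - w0) \<longlongrightarrow> 0) (at x)"
  proof (rule Lim_null_comparison)
    show "\<forall>\<^sub>F y in at x. norm (inv (A y) v - w0) \<le> norm (v - A y w0) / (m - d y)"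
      using ev_d ev_V by eventually_elim (rule bound)
    have "((\<lambda>y. norm (v - A y w0) / (m - d y)) \<longlongrightarrow> norm (v - A x w0) / (m - 0)) (at x)"
      using m(1) by (intro tendsto_intros lim lim_d) auto
    moreover have "A x w0 = v"
      unfolding w0_def using bij[OF x] by (simp add: bij_is_surj surj_f_inv_f)
    ultimately show "((\<lambda>y. norm (v - A y w0) / (m - d y)) \<longlongrightarrow> 0) (at x)"
      by simp
  qed
  then show "isCont (\<lambda>y. inv (A y) v) x"
    unfolding continuous_within w0_def[symmetric] using Lim_null by fastforce
qed

text \<open>The derivative of the inverse is minus inverse, derivative of \<open>A\<close>, inverse.
  It involves the inverse itself but not its derivatives, so the induction on the order
  closes.\<close>

lemma Ck_on_inv_linear:
  fixes A :: "'c::euclidean_space \<Rightarrow> 'a::euclidean_space \<Rightarrow> 'a"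
  assumes V: "open V"
    and lin: "\<And>y. y \<in> V \<Longrightarrow> linear (A y)" and bij: "\<And>y. y \<in> V \<Longrightarrow> bij (A y)"
  shows "(\<And>w. Ck_on n (\<lambda>y. A y w) V) \<Longrightarrow> Ck_on n (\<lambda>y. inv (A y) v) V"
proof (induction n arbitrary: v)
  case 0
  then show ?case
    using continuous_on_inv_linear[OF V lin bij] by simp
next
  case (Suc n)
  define B where "B y = inv (A y)" for y
  have linB: "linear (B y)" if "y \<in> V" for y
    unfolding B_def using inv_linear_bij[OF lin[OF that] bij[OF that]] .
  have AB: "A y (B y z) = z" and BA: "B y (A y z) = z" if "y \<in> V" for y z
    unfolding B_def using bij[OF that] by (auto simp: bij_is_surj surj_f_inv_f bij_is_inj inv_f_f)
  have "\<exists>A'. (\<forall>x\<in>V. ((\<lambda>y. A y w) has_derivative A' x) (at x)) \<and> (\<forall>h. Ck_on n (\<lambda>x. A' x h) V)" for w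
    using Suc.prems[of w] by simp
  then obtain A' where A': "\<And>w x. x \<in> V \<Longrightarrow> ((\<lambda>y. A y w) has_derivative A' w x) (at x)"
    "\<And>w h. Ck_on n (\<lambda>x. A' w x h) V"
    by metis
  have CB: "Ck_on n (\<lambda>y. B y z) V" for z
    unfolding B_def using Suc by (auto intro: Ck_on_Suc_imp simp del: Ck_on.simps)
  then have "continuous_on V (\<lambda>y. B y z)" for z
    by (rule Ck_on_imp_continuous_on)
  then have contB: "continuous (at x) (\<lambda>y. B y z)" if "x \<in> V" for x z
    using that V by (simp add: continuous_on_eq_continuous_at)
  \<comment> \<open>In coordinates \<open>D x h\<close> is minus \<open>B x\<close> applied to the
    derivative of \<open>A\<close> in direction \<open>h\<close>, taken at the vector
    \<open>B x v\<close>.\<close>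
  define D where "D x h = - (\<Sum>b\<in>Basis. (\<Sum>c\<in>Basis. (B x v \<bullet> c) * (A' c x h \<bullet> b)) *\<^sub>R B x b)" for x h
  have "((\<lambda>y. B y v) has_derivative D x) (at x)" if x: "x \<in> V" for x
  proof -
    define w where "w = B x v"
    \<comment> \<open>The identity behind the derivative is
      \<open>B y v = w - B y (A y w - A x w)\<close>. The coefficients \<open>u b y\<close> of the
      bracket vanish at \<open>y = x\<close>, so continuity of \<open>B\<close> suffices to
      differentiate the right-hand side.\<close>
    define u where "u b y = (\<Sum>c\<in>Basis. (w \<bullet> c) * ((A y c - A x c) \<bullet> b))" for b y
    have der_u: "(u b has_derivative (\<lambda>h. \<Sum>c\<in>Basis. (w \<bullet> c) * (A' c x h \<bullet> b))) (at x)" for b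
      unfolding u_def by (auto intro!: derivative_eq_intros A'(1)[OF x])
    have "((\<lambda>y. w - (\<Sum>b\<in>Basis. u b y *\<^sub>R B y b)) has_derivative
        (\<lambda>h. 0 - (\<Sum>b\<in>Basis. (\<Sum>c\<in>Basis. (w \<bullet> c) * (A' c x h \<bullet> b)) *\<^sub>R B x b))) (at x)"
      by (intro has_derivative_diff has_derivative_const has_derivative_sum
          has_derivative_scaleR_vanishing der_u contB x) (simp add: u_def)
    moreover have "w - (\<Sum>b\<in>Basis. u b y *\<^sub>R B y b) = B y v" if y: "y \<in> V" for y
    proof -
      have "u b y = (A y w - A x w) \<bullet> b" for b
        unfolding u_def linear_expand[OF lin[OF y], of w] linear_expand[OF lin[OF x], of w]
        by (simp add: inner_diff_left inner_sum_left sum_subtractf right_diff_distrib)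
      then have "(\<Sum>b\<in>Basis. u b y *\<^sub>R B y b) = B y (A y w - A x w)"
        by (simp add: linear_expand[OF linB[OF y], of "A y w - A x w"])
      also have "\<dots> = w - B y v"
        using linB[OF y] by (simp add: linear_diff BA y w_def AB[OF x])
      finally show ?thesis
        by simp
    qed
    ultimately show ?thesis
      using has_derivative_transform_within_open[OF _ V x, of _ _ UNIV "\<lambda>y. B y v"]
      by (simp add: D_def[abs_def] w_def)
  qed
  moreover have "Ck_on n (\<lambda>x. D x h) V" for h
  proof -
    have "Ck_on n (\<lambda>x. (-1) *\<^sub>R (\<Sum>b\<in>Basis. (\<Sum>c\<in>Basis. (B x v \<bullet> c) *\<^sub>R (A' c x h \<bullet> b)) *\<^sub>R B x b)) V"
      by (intro Ck_on_scaleR Ck_on_const Ck_on_sum Ck_on_inner CB A'(2))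
    then show ?thesis
      by (simp add: D_def)
  qed
  ultimately show ?case
    unfolding Ck_on.simps B_def[symmetric] by (intro exI[of _ D]) auto
qed

section \<open>Regular level sets\<close>

text \<open>The kernel of \<open>A\<close> and the range of its right inverse \<open>G\<close> are
  complementary, and \<open>G\<close> is injective.\<close>

lemma dim_kernel_surj:
  fixes A :: "'a::euclidean_space \<Rightarrow> 'b::euclidean_space"
  assumes A: "linear A" and G: "linear G" and AG: "\<And>z. A (G z) = z"
  shows "dim {x. A x = 0} = DIM('a) - DIM('b)"
proof -
  have s: "subspace {x. A x = 0}" "subspace (range G)"
    using A G linear_subspace_kernel by (auto intro: linear_subspace_image)
  have "dim (range G) = DIM('b)"
    by (metis AG G dim_UNIV dim_image_eq injI inj_on_subset subset_UNIV)
  moreover have "{x + y | x y. x \<in> {x. A x = 0} \<and> y \<in> range G} = UNIV"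
  proof -
    have "z = (z - G (A z)) + G (A z)" "A (z - G (A z)) = 0" for z
      using A by (auto simp: AG linear_diff)
    then show ?thesis
      by blast
  qed
  moreover have "{x. A x = 0} \<inter> range G = {0}"
    using A G by (auto simp: AG linear_0 image_iff intro!: exI[of _ 0])
  ultimately show ?thesis
    using dim_sums_Int[OF s] by simp
qed

text \<open>The inverse function theorem gives a local inverse \<open>g\<close> whose derivative is
  the inverse of the derivative of \<open>f\<close> at \<open>g y\<close>. If \<open>g\<close> is of
  order \<open>n\<close>, so is this derivative, and hence \<open>g\<close> is of order
  \<open>n + 1\<close>.\<close>

lemma smooth_inverse:
  fixes f :: "'a::euclidean_space \<Rightarrow> 'a"
  assumes f: "smooth_on f UNIV" and der: "(f has_derivative id) (at x0)"
  obtains U V g where "open U" "x0 \<in> U" "open V" "homeomorphism U V f g"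
    "smooth_on f U" "smooth_on g V"
proof -
  have "\<exists>f'. (\<forall>x. (f has_derivative f' x) (at x)) \<and> (\<forall>v. Ck_on n (\<lambda>x. f' x v) UNIV)" for n
    using f[unfolded smooth_on_def, rule_format, of "Suc n"] by simp
  then obtain F where F: "\<And>n x. (f has_derivative F n x) (at x)" "\<And>n v. Ck_on n (\<lambda>x. F n x v) UNIV"
    by metis
  \<comment> \<open>Each order of smoothness comes with its own derivative family; uniqueness of
    derivatives identifies them all.\<close>
  have "F n = F 0" for n
    using F(1) has_derivative_unique by blast
  then have CF: "Ck_on n (\<lambda>x. F 0 x v) UNIV" for n v
    using F(2)[where n = n] by metis
  define f' where "f' x = Blinfun (F 0 x)" for x
  have app: "blinfun_apply (f' x) = F 0 x" for x
    unfolding f'_def using F(1) has_derivative_bounded_linear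
    by (blast intro: bounded_linear_Blinfun_apply)
  have cont: "continuous_on UNIV f'"
    using CF[of 0] by (intro continuous_on_blinfun_componentwise) (simp add: app)
  have "F 0 x0 = id"
    using F(1) der has_derivative_unique by blast
  \<comment> \<open>At \<open>x0\<close> the derivative is the identity, which is thus its own
    inverse in the inverse function theorem.\<close>
  then have id: "id_blinfun o\<^sub>L f' x0 = id_blinfun"
    by (intro blinfun_eqI) (simp add: app)
  obtain U V g g' where U: "open U" "x0 \<in> U" "open V" "homeomorphism U V f g"
    and g: "\<And>y. y \<in> V \<Longrightarrow> (g has_derivative g' y) (at y)"
    and g': "\<And>y. y \<in> V \<Longrightarrow> g' y = inv (blinfun_apply (f' (g y)))"
      "\<And>y. y \<in> V \<Longrightarrow> bij (blinfun_apply (f' (g y)))"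
    using inverse_function_theorem[OF open_UNIV _ cont UNIV_I id] F(1) unfolding app by metis
  have "Ck_on n g V" for n
  proof (induction n)
    case 0
    then show ?case
      using U(4) by (simp add: homeomorphism_def)
  next
    case (Suc n)
    have "Ck_on n (\<lambda>y. inv (F 0 (g y)) v) V" for v
    proof (rule Ck_on_inv_linear[OF U(3)])
      show "linear (F 0 (g y))" for y
        using F(1) has_derivative_linear by blast
      show "bij (F 0 (g y))" if "y \<in> V" for y
        using g'(2)[OF that] by (simp add: app)
      show "Ck_on n (\<lambda>y. F 0 (g y) w) V" for w
        using Ck_on_compose[OF U(3) Suc CF] by simp
    qed
    then have "Ck_on n (\<lambda>y. g' y v) V" for v
      using Ck_on_cong[OF U(3), of "\<lambda>y. inv (F 0 (g y)) v" "\<lambda>y. g' y v"] g'(1) by (simp add: app)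
    then show ?case
      using g by auto
  qed
  moreover have "smooth_on f U"
    using f unfolding smooth_on_def by (blast intro: Ck_on_subset)
  ultimately show thesis
    using that U unfolding smooth_on_def by blast
qed

text \<open>
  With \<open>A\<close> the derivative of \<open>F\<close> at a point \<open>x0\<close> of the level set and \<open>G\<close> a right inverse of \<open>A\<close>,
  the map \<open>\<phi> x = (x - x0) - G (A (x - x0)) + G (F x)\<close> has derivative the identity at \<open>x0\<close>,
  and \<open>A (\<phi> x) = F x\<close>: so \<open>\<phi>\<close> straightens the level set to the kernel of \<open>A\<close>.
\<close>

theorem submanifold_level_set:
  fixes F :: "'a::euclidean_space \<Rightarrow> 'b::euclidean_space"
  assumes F: "smooth_on F UNIV"
    and der: "\<And>x. F x = 0 \<Longrightarrow> (F has_derivative F' x) (at x)"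
    and surj: "\<And>x z. F x = 0 \<Longrightarrow> \<exists>v. F' x v = z"
  shows "submanifold_of_dim (DIM('a) - DIM('b)) {x. F x = 0}"
  unfolding submanifold_of_dim_def
proof
  fix x0 assume "x0 \<in> {x. F x = 0}"
  then have x0: "F x0 = 0"
    by simp
  define A where "A = F' x0"
  have A: "bounded_linear A"
    unfolding A_def using der[OF x0] has_derivative_bounded_linear by blast
  then have linA: "linear A"
    by (rule bounded_linear.linear)
  have "surj A"
    using surj[OF x0] unfolding A_def surj_def by metis
  then obtain G where linG: "linear G" and AG: "A (G z) = z" for z
    using linear_surjective_right_inverse[OF linA] by (auto simp: fun_eq_iff)
  then have G: "bounded_linear G"
    using linear_conv_bounded_linear by blast
  have GA: "bounded_linear (\<lambda>x. x - G (A x))"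
    by (intro bounded_linear_sub bounded_linear_ident bounded_linear_compose[OF G A])
  define \<phi> where "\<phi> x = (x - G (A x)) + (- (x0 - G (A x0)) + G (F x))" for x
  have "Ck_on n \<phi> UNIV" for n
    unfolding \<phi>_def
    using F by (intro Ck_on_add Ck_on_linear[OF GA] Ck_on_const Ck_on_compose[OF open_UNIV _ Ck_on_linear[OF G]])
      (auto simp: smooth_on_def)
  then have smooth: "smooth_on \<phi> UNIV"
    by (simp add: smooth_on_def)
  have "(\<phi> has_derivative (\<lambda>h. (h - G (A h)) + (0 + G (A h)))) (at x0)"
    unfolding \<phi>_def
    by (intro has_derivative_add bounded_linear_imp_has_derivative[OF GA] has_derivative_const
        bounded_linear.has_derivative[OF G] der[OF x0, folded A_def])
  then have "(\<phi> has_derivative id) (at x0)"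
    by (simp add: id_def)
  then obtain U V \<psi> where *: "open U" "x0 \<in> U" "open V" "homeomorphism U V \<phi> \<psi>"
    "smooth_on \<phi> U" "smooth_on \<psi> V"
    using smooth_inverse[OF smooth] by metis
  have "A (\<phi> x) = F x" for x
    unfolding \<phi>_def using linA by (simp add: linear_add linear_diff linear_neg AG)
  moreover have "\<phi> ` U = V"
    using *(4) by (simp add: homeomorphism_def)
  ultimately have "\<phi> ` ({x. F x = 0} \<inter> U) = V \<inter> {x. A x = 0}"
    by force
  moreover have "subspace {x. A x = 0}"
    using linA by (rule linear_subspace_kernel)
  ultimately show "\<exists>U V (\<phi> :: 'a \<Rightarrow> 'a) \<psi> T. open U \<and> x0 \<in> U \<and> open V \<and> smooth_on \<phi> U \<and> smooth_on \<psi> V \<and>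
      homeomorphism U V \<phi> \<psi> \<and> subspace T \<and> dim T = DIM('a) - DIM('b) \<and>
      \<phi> ` ({x. F x = 0} \<inter> U) = V \<inter> T"
    using * dim_kernel_surj[OF linA linG AG] by blast
qed

section \<open>The loci are submanifolds\<close>

lemmas Ck_on_intros = Ck_on_add Ck_on_Pair Ck_on_const Ck_on_inner Ck_on_scaleR

lemma bounded_bilinear_cross3: "bounded_bilinear cross3"
  using bilinear_cross bilinear_conv_bounded_bilinear by blast

lemmas has_derivative_cross3 [derivative_intros] = bounded_bilinear.FDERIV[OF bounded_bilinear_cross3]

lemmas Ck_on_cross3 = Ck_on_bilinear[OF bounded_bilinear_cross3]

lemma Ck_on_diff: "Ck_on n f U \<Longrightarrow> Ck_on n g U \<Longrightarrow> Ck_on n (\<lambda>x. f x - g x) U"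
  using Ck_on_add[of n f U "\<lambda>x. (- 1) *\<^sub>R g x"] Ck_on_scaleR[OF Ck_on_const, of n g U "- 1"] by simp

lemma Ck_on_coords:
  fixes U :: "carroll_dual set"
  shows "Ck_on n fst U" "Ck_on n (\<lambda>x. fst (snd x)) U" "Ck_on n (\<lambda>x. fst (snd (snd x))) U"
    "Ck_on n (\<lambda>x. snd (snd (snd x))) U"
  by (intro Ck_on_linear bounded_linear_intros)+

section \<open>Dimensions of the loci with nonzero energy\<close>

text \<open>As \<open>E0\<close> is nonzero, variations of \<open>j\<close> and \<open>E\<close>
  alone realise every value of the derivative. Four scalar equations in ten variables leave
  dimension 6.\<close>

lemma submanifold_type1:
  assumes "E0 \<noteq> 0"
  shows "submanifold_of_dim 6 (locus (Type1 E0))"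
proof -
  define F where "F x = (snd (snd (snd x)) - E0,
    E0 *\<^sub>R fst x + cross3 (fst (snd (snd x))) (fst (snd x)))" for x :: carroll_dual
  define F' where "F' x v = (snd (snd (snd v)), E0 *\<^sub>R fst v
    + (cross3 (fst (snd (snd x))) (fst (snd v)) + cross3 (fst (snd (snd v))) (fst (snd x))))" for x v :: carroll_dual
  have "submanifold_of_dim (DIM(carroll_dual) - DIM(real \<times> (real^3))) {x. F x = 0}"
  proof (rule submanifold_level_set)
    show "smooth_on F UNIV"
      unfolding smooth_on_def F_def by (intro allI Ck_on_intros Ck_on_diff Ck_on_cross3 Ck_on_coords)
    show "(F has_derivative F' x) (at x)" for x
      unfolding F_def F'_def by (auto intro!: derivative_eq_intros simp: fun_eq_iff)
    show "\<exists>v. F' x v = z" for x z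
      using assms by (intro exI[of _ "(inverse E0 *\<^sub>R snd z, 0, 0, fst z)"]) (simp add: F'_def)
  qed
  moreover have "{x. F x = 0} = locus (Type1 E0)"
    by (auto simp: F_def zero_prod_def)
  ultimately show ?thesis
    by simp
qed

text \<open>The norm condition is squared to become smooth everywhere. The two equations are
  independent because \<open>w\<close> is nonzero on the locus.\<close>

lemma submanifold_type2:
  assumes "E0 \<noteq> 0" "S > 0"
  shows "submanifold_of_dim 8 (locus (Type2 E0 S))"
proof -
  define w where "w x = fst x + inverse E0 *\<^sub>R cross3 (fst (snd (snd x))) (fst (snd x))" for x :: carroll_dual
  define w' where "w' x v = fst v + inverse E0 *\<^sub>R
    (cross3 (fst (snd (snd x))) (fst (snd v)) + cross3 (fst (snd (snd v))) (fst (snd x)))" for x v :: carroll_dual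
  define F where "F x = (snd (snd (snd x)) - E0, w x \<bullet> w x - S\<^sup>2)" for x :: carroll_dual
  define F' where "F' x v = (snd (snd (snd v)), 2 * (w x \<bullet> w' x v))" for x v :: carroll_dual
  have "submanifold_of_dim (DIM(carroll_dual) - DIM(real \<times> real)) {x. F x = 0}"
  proof (rule submanifold_level_set)
    show "smooth_on F UNIV"
      unfolding smooth_on_def F_def w_def
      by (intro allI Ck_on_intros Ck_on_diff Ck_on_cross3 Ck_on_coords)
    have [derivative_intros]: "(w has_derivative w' x) (at x)" for x
      unfolding w_def w'_def by (auto intro!: derivative_eq_intros simp: fun_eq_iff)
    show "(F has_derivative F' x) (at x)" for x
      unfolding F_def F'_def
      by (auto intro!: derivative_eq_intros simp: fun_eq_iff inner_commute)
    fix x z assume "F x = 0"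
    then have "w x \<bullet> w x = S\<^sup>2"
      by (simp add: F_def zero_prod_def)
    then show "\<exists>v. F' x v = z"
      using assms
      \<comment> \<open>Moving \<open>j\<close> along \<open>w x\<close> moves \<open>w\<close> by
        the same vector, so its squared length changes at rate \<open>2 * S\<^sup>2\<close> per unit
        coefficient.\<close>
      by (intro exI[of _ "((snd z / (2 * S\<^sup>2)) *\<^sub>R w x, 0, 0, fst z)"]) (simp add: F'_def w'_def)
  qed
  moreover have "{x. F x = 0} = locus (Type2 E0 S)"
    using assms by (auto simp: F_def w_def zero_prod_def norm_eq_sqrt_inner power2_eq_square)
  ultimately show ?thesis
    by simp
qed

section \<open>Dimensions of the loci with zero energy\<close>

lemma submanifold_type3: "submanifold_of_dim 0 (locus Type3)"
proof -
  have "submanifold_of_dim (DIM(carroll_dual) - DIM(carroll_dual)) {x :: carroll_dual. id x = 0}"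
    by (rule submanifold_level_set[where F' = "\<lambda>x. id"])
      (auto simp: smooth_on_def id_def intro!: Ck_on_linear bounded_linear_ident)
  moreover have "{x :: carroll_dual. id x = 0} = locus Type3"
    by (auto simp: zero_prod_def)
  ultimately show ?thesis
    by simp
qed

lemma submanifold_type4:
  assumes "j0 > 0"
  shows "submanifold_of_dim 2 (locus (Type4 j0))"
proof -
  define F where "F x = (snd (snd (snd x)), fst (snd (snd x)), fst (snd x), fst x \<bullet> fst x - j0\<^sup>2)"
    for x :: carroll_dual
  define F' where "F' x v = (snd (snd (snd v)), fst (snd (snd v)), fst (snd v), 2 * (fst x \<bullet> fst v))"
    for x v :: carroll_dual
  have "submanifold_of_dim (DIM(carroll_dual) - DIM(real \<times> (real^3) \<times> (real^3) \<times> real)) {x. F x = 0}"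
  proof (rule submanifold_level_set)
    show "smooth_on F UNIV"
      unfolding smooth_on_def F_def by (intro allI Ck_on_intros Ck_on_diff Ck_on_coords)
    show "(F has_derivative F' x) (at x)" for x
      unfolding F_def F'_def
      by (auto intro!: derivative_eq_intros simp: fun_eq_iff inner_commute)
    fix x z assume "F x = 0"
    then have "fst x \<bullet> fst x = j0\<^sup>2"
      by (simp add: F_def zero_prod_def)
    then show "\<exists>v. F' x v = z"
      using assms
      by (intro exI[of _ "((snd (snd (snd z)) / (2 * j0\<^sup>2)) *\<^sub>R fst x,
          fst (snd (snd z)), fst (snd z), fst z)"]) (simp add: F'_def)
  qed
  moreover have "{x. F x = 0} = locus (Type4 j0)"
    using assms by (auto simp: F_def zero_prod_def norm_eq_sqrt_inner power2_eq_square)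
  ultimately show ?thesis
    by simp
qed

text \<open>On the locus \<open>norm k\<close> is the constant \<open>k0\<close>, so the last
  equation can be made polynomial by putting \<open>h * k0\<close> on its right-hand side.\<close>

lemma submanifold_type5:
  assumes "k0 > 0"
  shows "submanifold_of_dim 4 (locus (Type5 k0 h))"
proof -
  define F where "F x = (snd (snd (snd x)), fst (snd (snd x)),
    fst (snd x) \<bullet> fst (snd x) - k0\<^sup>2, fst x \<bullet> fst (snd x) - h * k0)" for x :: carroll_dual
  define F' where "F' x v = (snd (snd (snd v)), fst (snd (snd v)),
    2 * (fst (snd x) \<bullet> fst (snd v)), fst x \<bullet> fst (snd v) + fst v \<bullet> fst (snd x))" for x v :: carroll_dual
  have "submanifold_of_dim (DIM(carroll_dual) - DIM(real \<times> (real^3) \<times> real \<times> real)) {x. F x = 0}"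
  proof (rule submanifold_level_set)
    show "smooth_on F UNIV"
      unfolding smooth_on_def F_def by (intro allI Ck_on_intros Ck_on_diff Ck_on_coords)
    show "(F has_derivative F' x) (at x)" for x
      unfolding F_def F'_def
      by (auto intro!: derivative_eq_intros simp: fun_eq_iff inner_commute)
    fix x and z :: "real \<times> (real^3) \<times> real \<times> real" assume "F x = 0"
    moreover obtain j k p E where x: "x = (j, k, p, E)"
      by (cases x) auto
    ultimately have k: "k \<bullet> k = k0\<^sup>2"
      by (simp add: F_def zero_prod_def)
    obtain a b c d where z: "z = (a, b, c, d)"
      by (cases z) auto
    \<comment> \<open>The system is triangular: \<open>dk\<close> produces the value
      \<open>c\<close> for the squared length of \<open>k\<close>, then a variation of
      \<open>j\<close> along \<open>k\<close> corrects the last component.\<close>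
    define dk where "dk = (c / (2 * k0\<^sup>2)) *\<^sub>R k"
    have "F' x (((d - j \<bullet> dk) / k0\<^sup>2) *\<^sub>R k, dk, b, a) = z"
      using assms by (simp add: F'_def x z k) (simp add: dk_def k)
    then show "\<exists>v. F' x v = z" ..
  qed
  moreover have "{x. F x = 0} = locus (Type5 k0 h)"
    using assms by (auto simp: F_def zero_prod_def norm_eq_sqrt_inner power2_eq_square)
  ultimately show ?thesis
    by simp
qed

text \<open>Covers types 6 and 7 together: \<open>m = 0\<close> gives type 6, and \<open>m\<close>
  equal to plus or minus \<open>k0 / p0\<close> gives type 7.\<close>

lemma submanifold_parallel:
  assumes "p0 > 0"
  shows "submanifold_of_dim 4
    ({(j, k, p, E). E = 0 \<and> k = m *\<^sub>R p \<and> norm p = p0 \<and> j \<bullet> p = h * norm p} :: carroll_dual set)"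
proof -
  define F where "F x = (snd (snd (snd x)), fst (snd x) - m *\<^sub>R fst (snd (snd x)),
    fst (snd (snd x)) \<bullet> fst (snd (snd x)) - p0\<^sup>2, fst x \<bullet> fst (snd (snd x)) - h * p0)" for x :: carroll_dual
  define F' where "F' x v = (snd (snd (snd v)), fst (snd v) - m *\<^sub>R fst (snd (snd v)),
    2 * (fst (snd (snd x)) \<bullet> fst (snd (snd v))),
    fst x \<bullet> fst (snd (snd v)) + fst v \<bullet> fst (snd (snd x)))" for x v :: carroll_dual
  have "submanifold_of_dim (DIM(carroll_dual) - DIM(real \<times> (real^3) \<times> real \<times> real)) {x. F x = 0}"
  proof (rule submanifold_level_set)
    show "smooth_on F UNIV"
      unfolding smooth_on_def F_def by (intro allI Ck_on_intros Ck_on_diff Ck_on_coords)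
    show "(F has_derivative F' x) (at x)" for x
      unfolding F_def F'_def
      by (auto intro!: derivative_eq_intros simp: fun_eq_iff inner_commute)
    fix x and z :: "real \<times> (real^3) \<times> real \<times> real" assume "F x = 0"
    moreover obtain j k p E where x: "x = (j, k, p, E)"
      by (cases x) auto
    ultimately have p: "p \<bullet> p = p0\<^sup>2"
      by (simp add: F_def zero_prod_def)
    obtain a b c d where z: "z = (a, b, c, d)"
      by (cases z) auto
    define dp where "dp = (c / (2 * p0\<^sup>2)) *\<^sub>R p"
    have "F' x (((d - j \<bullet> dp) / p0\<^sup>2) *\<^sub>R p, b + m *\<^sub>R dp, dp, a) = z"
      using assms by (simp add: F'_def x z p) (simp add: dp_def p)
    then show "\<exists>v. F' x v = z" ..
  qed
  moreover have "{x. F x = 0} =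
      {(j, k, p, E). E = 0 \<and> k = m *\<^sub>R p \<and> norm p = p0 \<and> j \<bullet> p = h * norm p}"
    using assms by (auto simp: F_def zero_prod_def norm_eq_sqrt_inner power2_eq_square)
  ultimately show ?thesis
    by simp
qed

lemma submanifold_type6:
  assumes "p0 > 0"
  shows "submanifold_of_dim 4 (locus (Type6 p0 h))"
  using submanifold_parallel[OF assms, of 0 h] by simp

text \<open>The equality case of the Cauchy-Schwarz inequality for \<open>p\<close> and
  \<open>\<sigma> *\<^sub>R k\<close>.\<close>

lemma parallel_iff:
  fixes p k :: "'a::real_inner"
  assumes "norm p = p0" "p0 > 0" "k0 > 0" "\<sigma> \<in> {1, - 1}"
  shows "norm k = k0 \<and> p \<bullet> k = \<sigma> * (p0 * k0) \<longleftrightarrow> k = (\<sigma> * k0 / p0) *\<^sub>R p"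
proof
  assume a: "norm k = k0 \<and> p \<bullet> k = \<sigma> * (p0 * k0)"
  have "\<sigma> * \<sigma> = 1" "norm (\<sigma> *\<^sub>R k) = norm k"
    using assms by auto
  then have "p \<bullet> (\<sigma> *\<^sub>R k) = norm p * norm (\<sigma> *\<^sub>R k)"
    using a assms by auto
  then have "norm p *\<^sub>R (\<sigma> *\<^sub>R k) = norm (\<sigma> *\<^sub>R k) *\<^sub>R p"
    by (rule norm_cauchy_schwarz_eq[THEN iffD1])
  then have "p0 *\<^sub>R (\<sigma> *\<^sub>R k) = k0 *\<^sub>R p"
    using a assms(1) \<open>norm (\<sigma> *\<^sub>R k) = norm k\<close> by simp
  then have "(\<sigma> / p0) *\<^sub>R (p0 *\<^sub>R (\<sigma> *\<^sub>R k)) = (\<sigma> / p0) *\<^sub>R (k0 *\<^sub>R p)"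
    by simp
  then show "k = (\<sigma> * k0 / p0) *\<^sub>R p"
    using assms by (auto simp: \<open>\<sigma> * \<sigma> = 1\<close>)
next
  assume k: "k = (\<sigma> * k0 / p0) *\<^sub>R p"
  have "p \<bullet> p = p0 * p0"
    using assms(1) by (simp add: dot_square_norm power2_eq_square)
  then show "norm k = k0 \<and> p \<bullet> k = \<sigma> * (p0 * k0)"
    using assms by (auto simp: k abs_mult)
qed

text \<open>Besides giving regular equations, this form shows that a rotation taking
  \<open>p\<close> to \<open>p'\<close> automatically takes \<open>k\<close> to
  \<open>k'\<close>.\<close>

lemma locus_type7_eq:
  assumes "allowed (Type7 \<sigma> p0 k0 h)"
  shows "locus (Type7 \<sigma> p0 k0 h) =
    {(j, k, p, E). E = 0 \<and> k = (\<sigma> * k0 / p0) *\<^sub>R p \<and> norm p = p0 \<and> j \<bullet> p = h * norm p}"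
proof -
  have "E = 0 \<and> norm p = p0 \<and> norm k = k0 \<and> p \<bullet> k = \<sigma> * (p0 * k0) \<and> j \<bullet> p = h * norm p \<longleftrightarrow>
      E = 0 \<and> k = (\<sigma> * k0 / p0) *\<^sub>R p \<and> norm p = p0 \<and> j \<bullet> p = h * norm p"
    for j k p :: "real^3" and E :: real
    using parallel_iff[of p p0 k0 \<sigma> k] assms unfolding allowed.simps by blast
  then show ?thesis
    by (simp only: locus.simps)
qed

lemma submanifold_type7:
  assumes "allowed (Type7 \<sigma> p0 k0 h)"
  shows "submanifold_of_dim 4 (locus (Type7 \<sigma> p0 k0 h))"
  unfolding locus_type7_eq[OF assms] using assms by (intro submanifold_parallel) simp

text \<open>Strict Cauchy-Schwarz inequality, from \<open>sin \<theta> > 0\<close>: it expresses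
  that \<open>p\<close> and \<open>k\<close> are linearly independent.\<close>

lemma type8_inner_less:
  assumes "p0 > 0" "k0 > 0" "\<theta> \<in> {0<..<pi}"
  shows "(p0 * k0 * cos \<theta>)\<^sup>2 < p0\<^sup>2 * k0\<^sup>2"
proof -
  have "(cos \<theta>)\<^sup>2 < 1"
    using assms sin_gt_zero[of \<theta>] by (simp add: cos_squared_eq)
  then show ?thesis
    using assms by (simp add: power_mult_distrib)
qed

lemma submanifold_type8:
  assumes "p0 > 0" "k0 > 0" "\<theta> \<in> {0<..<pi}"
  shows "submanifold_of_dim 6 (locus (Type8 p0 k0 \<theta>))"
proof -
  define F where "F x = (snd (snd (snd x)), fst (snd (snd x)) \<bullet> fst (snd (snd x)) - p0\<^sup>2,
    fst (snd x) \<bullet> fst (snd x) - k0\<^sup>2, fst (snd (snd x)) \<bullet> fst (snd x) - p0 * k0 * cos \<theta>)" for x :: carroll_dual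
  define F' where "F' x v = (snd (snd (snd v)), 2 * (fst (snd (snd x)) \<bullet> fst (snd (snd v))),
    2 * (fst (snd x) \<bullet> fst (snd v)),
    fst (snd (snd x)) \<bullet> fst (snd v) + fst (snd (snd v)) \<bullet> fst (snd x))" for x v :: carroll_dual
  have "submanifold_of_dim (DIM(carroll_dual) - DIM(real \<times> real \<times> real \<times> real)) {x. F x = 0}"
  proof (rule submanifold_level_set)
    show "smooth_on F UNIV"
      unfolding smooth_on_def F_def by (intro allI Ck_on_intros Ck_on_diff Ck_on_coords)
    show "(F has_derivative F' x) (at x)" for x
      unfolding F_def F'_def
      by (auto intro!: derivative_eq_intros simp: fun_eq_iff inner_commute)
    fix x and z :: "real \<times> real \<times> real \<times> real" assume "F x = 0"
    moreover obtain j k p E where x: "x = (j, k, p, E)"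
      by (cases x) auto
    ultimately have p: "p \<bullet> p = p0\<^sup>2" and k: "k \<bullet> k = k0\<^sup>2" and pk: "p \<bullet> k = p0 * k0 * cos \<theta>"
      by (auto simp: F_def zero_prod_def)
    obtain a b c d where z: "z = (a, b, c, d)"
      by (cases z) auto
    \<comment> \<open>\<open>n\<close> is the component of \<open>p\<close> orthogonal to
      \<open>k\<close>; strict Cauchy-Schwarz gives \<open>p \<bullet> n \<noteq> 0\<close>.\<close>
    define n where "n = p - (p \<bullet> k / k0\<^sup>2) *\<^sub>R k"
    have "k \<bullet> n = 0"
      using assms by (simp add: n_def inner_diff_right k inner_commute)
    have "(p \<bullet> n) * k0\<^sup>2 = p0\<^sup>2 * k0\<^sup>2 - (p \<bullet> k)\<^sup>2"
      using assms by (simp add: n_def inner_diff_right p power2_eq_square field_simps)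
    then have "p \<bullet> n \<noteq> 0"
      using type8_inner_less[OF assms, folded pk] by (intro notI) simp
    \<comment> \<open>\<open>dp\<close> and the \<open>k\<close>-part of \<open>dk\<close> prescribe
      the two squared lengths. The \<open>n\<close>-part of \<open>dk\<close> then adjusts
      \<open>p \<bullet> k\<close> without disturbing the length of \<open>k\<close>.\<close>
    define dp where "dp = (b / (2 * p0\<^sup>2)) *\<^sub>R p"
    define dk where "dk = (c / (2 * k0\<^sup>2)) *\<^sub>R k
      + ((d - dp \<bullet> k - c / (2 * k0\<^sup>2) * (p \<bullet> k)) / (p \<bullet> n)) *\<^sub>R n"
    have "p \<bullet> dp = b / 2" "k \<bullet> dk = c / 2"
      using assms by (auto simp: dp_def dk_def p k inner_add_right \<open>k \<bullet> n = 0\<close>)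
    moreover have "p \<bullet> dk = d - dp \<bullet> k"
      using \<open>p \<bullet> n \<noteq> 0\<close> by (simp add: dk_def inner_add_right)
    ultimately have "F' x (0, dk, dp, a) = z"
      by (simp add: F'_def x z)
    then show "\<exists>v. F' x v = z" ..
  qed
  moreover have "{x. F x = 0} = locus (Type8 p0 k0 \<theta>)"
    using assms by (auto simp: F_def zero_prod_def norm_eq_sqrt_inner power2_eq_square)
  ultimately show ?thesis
    by simp
qed

lemma submanifold_locus: "allowed t \<Longrightarrow> submanifold_of_dim (orbit_dim t) (locus t)"
  by (cases t) (simp_all add: submanifold_type1 submanifold_type2 submanifold_type3 submanifold_type4
      submanifold_type5 submanifold_type6 submanifold_type7 submanifold_type8 del: locus.simps)

section \<open>The loci partition the dual\<close>

lemma ex_locus: "\<exists>t. allowed t \<and> \<alpha> \<in> locus t"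
proof -
  obtain j k p E where \<alpha>: "\<alpha> = (j, k, p, E)"
    by (cases \<alpha>) auto
  consider "E \<noteq> 0" "E *\<^sub>R j + cross3 p k = 0" | "E \<noteq> 0" "E *\<^sub>R j + cross3 p k \<noteq> 0"
    | "E = 0" "p = 0" "k = 0" "j = 0" | "E = 0" "p = 0" "k = 0" "j \<noteq> 0"
    | "E = 0" "p = 0" "k \<noteq> 0" | "E = 0" "p \<noteq> 0" "k = 0"
    | "E = 0" "p \<noteq> 0" "k \<noteq> 0" "\<bar>p \<bullet> k\<bar> = norm p * norm k"
    | "E = 0" "p \<noteq> 0" "k \<noteq> 0" "\<bar>p \<bullet> k\<bar> \<noteq> norm p * norm k"
    by blast
  then show ?thesis
  proof cases
    case 1
    then show ?thesis
      by (intro exI[of _ "Type1 E"]) (simp add: \<alpha>)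
  next
    case 2
    have "E *\<^sub>R (j + inverse E *\<^sub>R cross3 p k) \<noteq> 0"
      using 2 by (simp add: scaleR_add_right)
    then have "j + inverse E *\<^sub>R cross3 p k \<noteq> 0"
      by auto
    with 2 show ?thesis
      by (intro exI[of _ "Type2 E (norm (j + inverse E *\<^sub>R cross3 p k))"]) (simp add: \<alpha>)
  next
    case 3
    then show ?thesis
      by (intro exI[of _ Type3]) (simp add: \<alpha>)
  next
    case 4
    then show ?thesis
      by (intro exI[of _ "Type4 (norm j)"]) (simp add: \<alpha>)
  next
    case 5
    then show ?thesis
      by (intro exI[of _ "Type5 (norm k) (j \<bullet> k / norm k)"]) (simp add: \<alpha>)
  next
    case 6
    then show ?thesis
      by (intro exI[of _ "Type6 (norm p) (j \<bullet> p / norm p)"]) (simp add: \<alpha>)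
  next
    \<comment> \<open>The sign of type 7 is the sign of \<open>p \<bullet> k\<close>.\<close>
    case 7
    then show ?thesis
      by (intro exI[of _ "Type7 (if p \<bullet> k \<ge> 0 then 1 else - 1) (norm p) (norm k) (j \<bullet> p / norm p)"])
        (auto simp: \<alpha>)
  next
    case 8
    have pos: "norm p * norm k > 0"
      using 8 by simp
    \<comment> \<open>\<open>q\<close> is the cosine of the angle between \<open>p\<close> and
      \<open>k\<close>. Excluding equality in Cauchy-Schwarz puts it strictly between -1 and 1,
      hence its \<open>arccos\<close> strictly between 0 and \<open>pi\<close>.\<close>
    define q where "q = (p \<bullet> k) / (norm p * norm k)"
    have "\<bar>p \<bullet> k\<bar> < norm p * norm k"
      using 8 Cauchy_Schwarz_ineq2[of p k] by simp
    then have "\<bar>q\<bar> < 1"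
      using pos by (simp add: q_def abs_divide abs_mult)
    then have "arccos q \<in> {0<..<pi}" "cos (arccos q) = q"
      using arccos_lt_bounded[of q] by (auto simp: abs_less_iff)
    then show ?thesis
      using 8 by (intro exI[of _ "Type8 (norm p) (norm k) (arccos q)"]) (simp add: \<alpha> q_def)
  qed
qed

text \<open>Most pairs of families differ in which of \<open>E\<close>, \<open>p\<close>,
  \<open>k\<close>, \<open>j\<close> vanish, and most parameters can be read off. Types 1 and 2 are
  told apart by the spin, types 7 and 8 by \<open>cos \<theta>\<close> not being 1 or -1, and the
  angle of type 8 is determined by injectivity of the cosine.\<close>

lemma locus_disjoint:
  assumes "allowed t" "allowed t'" "\<alpha> \<in> locus t" "\<alpha> \<in> locus t'"
  shows "t = t'"
proof -
  have spin: "E0 *\<^sub>R j + cross3 p k \<noteq> 0"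
    if "E0 \<noteq> 0" "norm (j + inverse E0 *\<^sub>R cross3 p k) > 0" for E0 j p k
  proof
    assume "E0 *\<^sub>R j + cross3 p k = 0"
    then have "inverse E0 *\<^sub>R (E0 *\<^sub>R j + cross3 p k) = 0"
      by simp
    then show False
      using that by (simp add: scaleR_add_right)
  qed
  have cos_inj: "\<theta> = \<theta>'" if "cos \<theta> = cos \<theta>'" "\<theta> \<in> {0<..<pi}" "\<theta>' \<in> {0<..<pi}" for \<theta> \<theta>'
    using that cos_inj_pi[of \<theta> \<theta>'] by auto
  have cos_neq: "cos \<theta> \<noteq> 1 \<and> cos \<theta> \<noteq> - 1" if "0 < \<theta>" "\<theta> < pi" for \<theta> :: real
  proof -
    have "(cos \<theta>)\<^sup>2 \<noteq> 1"
      using that sin_gt_zero[of \<theta>] by (simp add: cos_squared_eq)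
    then show ?thesis
      by auto
  qed
  obtain j k p E where "\<alpha> = (j, k, p, E)"
    by (cases \<alpha>) auto
  with assms show ?thesis
    by (cases t; cases t') (auto dest: spin cos_inj cos_neq)
qed

section \<open>The loci are orbits\<close>

lemma coadjoint_orbit_eq:
  "coadjoint_orbit (j, k, p, E) =
    {(R *v j + cross3 v (R *v k) + cross3 a (R *v p) + E *\<^sub>R cross3 v a,
      R *v k + E *\<^sub>R a, R *v p - E *\<^sub>R v, E) | R v a. rotation_matrix R}"
  (is "_ = {?\<beta> R v a | R v a. _}")
proof -
  have coAd_eq: "coAd (carroll R v a s) (j, k, p, E) = ?\<beta> R v a" if "rotation_matrix R" for R v a s
    using that by (rule coAd_formula)
  show ?thesis
  proof (intro set_eqI iffI)
    fix \<beta> assume "\<beta> \<in> coadjoint_orbit (j, k, p, E)"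
    then obtain R v a s where R: "rotation_matrix R" and "\<beta> = coAd (carroll R v a s) (j, k, p, E)"
      unfolding coadjoint_orbit_def carroll_group_def by blast
    then have "\<beta> = ?\<beta> R v a"
      by (simp only: coAd_eq)
    with R show "\<beta> \<in> {?\<beta> R v a | R v a. rotation_matrix R}"
      by blast
  next
    fix \<beta> assume "\<beta> \<in> {?\<beta> R v a | R v a. rotation_matrix R}"
    then obtain R v a where R: "rotation_matrix R" and \<beta>: "\<beta> = ?\<beta> R v a"
      by blast
    \<comment> \<open>The central parameter \<open>s\<close> acts trivially, so 0 is as good as any
      other value.\<close>
    have "\<beta> = coAd (carroll R v a 0) (j, k, p, E)"
      unfolding \<beta> by (rule coAd_eq[OF R, symmetric])
    with R show "\<beta> \<in> coadjoint_orbit (j, k, p, E)"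
      unfolding coadjoint_orbit_def carroll_group_def by blast
  qed
qed

section \<open>Rotations of vectors and of pairs of vectors\<close>

lemma rotation_transformation:
  fixes R :: "real^'n^'n"
  shows "rotation_matrix R \<Longrightarrow> orthogonal_transformation ((*v) R)"
  unfolding orthogonal_transformation_matrix by (simp add: rotation_matrix_def)

lemma rotation_inner:
  fixes R :: "real^'n^'n"
  assumes "rotation_matrix R"
  shows "(R *v x) \<bullet> (R *v y) = x \<bullet> y"
  using rotation_transformation[OF assms] by (simp add: orthogonal_transformation_def)

lemma rotation_norm:
  fixes R :: "real^'n^'n"
  assumes "rotation_matrix R"
  shows "norm (R *v x) = norm x"
  using orthogonal_transformation_norm[OF rotation_transformation[OF assms]] .

lemma ex_rotation:
  fixes x y :: "real^3"
  assumes "norm x = norm y"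
  obtains R where "rotation_matrix R" "R *v x = y"
proof -
  obtain f where f: "orthogonal_transformation f" "det (matrix f) = 1" "f x = y"
    using rotation_exists[OF _ assms] by auto
  then have "matrix f *v x = y"
    by (simp add: matrix_works orthogonal_transformation_linear)
  moreover have "rotation_matrix (matrix f)"
    using f by (simp add: rotation_matrix_def orthogonal_transformation_matrix)
  ultimately show thesis
    using that by blast
qed

text \<open>Completing each pair by its cross product gives two bases with the same Gram matrix, so
  the change of basis is orthogonal. Both bases are positively oriented, so it is a
  rotation.\<close>

lemma ex_rotation_pair:
  fixes p k p' k' :: "real^3"
  assumes n: "cross3 p k \<noteq> 0"
    and gram: "p' \<bullet> p' = p \<bullet> p" "k' \<bullet> k' = k \<bullet> k" "p' \<bullet> k' = p \<bullet> k"
  obtains R where "rotation_matrix R" "R *v p = p'" "R *v k = k'"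
proof -
  \<comment> \<open>The columns of \<open>M x y\<close> are \<open>x\<close>, \<open>y\<close> and
    \<open>cross3 x y\<close>.\<close>
  define M where "M x y = transpose (vector [x, y, cross3 x y] :: real^3^3)" for x y :: "real^3"
  have cols: "M x y *v axis 1 1 = x" "M x y *v axis 2 1 = y" for x y
    by (simp_all add: M_def vec_eq_iff forall_3 matrix_vector_mult_def sum_3 transpose_def axis_def)
  have det: "det (M x y) = cross3 x y \<bullet> cross3 x y" for x y
    by (simp add: M_def det_transpose flip: dot_cross_det) (simp add: cross3_simps)
  \<comment> \<open>By Lagrange's identity, the determinant and the third diagonal Gram entry depend
    only on the inner products of the pair.\<close>
  have cross_sq: "cross3 x y \<bullet> cross3 x y = (x \<bullet> x) * (y \<bullet> y) - (x \<bullet> y)\<^sup>2" for x y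
    by (simp add: cross3_simps power2_eq_square)
  have "transpose (M x y) ** M x y = vector [vector [x \<bullet> x, x \<bullet> y, 0], vector [x \<bullet> y, y \<bullet> y, 0],
      vector [0, 0, cross3 x y \<bullet> cross3 x y]]" for x y
    unfolding M_def
    by (simp add: vec_eq_iff forall_3 matrix_matrix_mult_def sum_3 transpose_def inner_vec_def
        cross3_def algebra_simps)
  then have MM: "transpose (M p' k') ** M p' k' = transpose (M p k) ** M p k"
    by (simp add: gram cross_sq)
  have "det (M p k) \<noteq> 0"
    using n by (simp add: det)
  then obtain N where inv: "M p k ** N = mat 1" "N ** M p k = mat 1"
    using invertible_det_nz invertible_def by blast
  define R where "R = M p' k' ** N"
  have RM: "R ** M p k = M p' k'"
    unfolding R_def by (metis inv(2) matrix_mul_assoc matrix_mul_rid)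
  have "transpose R ** R = transpose N ** (transpose (M p' k') ** M p' k') ** N"
    by (simp add: R_def matrix_transpose_mul matrix_mul_assoc)
  also have "\<dots> = transpose (M p k ** N) ** (M p k ** N)"
    by (simp add: MM matrix_transpose_mul matrix_mul_assoc)
  also have "\<dots> = mat 1"
    by (simp add: inv(1) transpose_mat)
  finally have "orthogonal_matrix R"
    by (simp add: orthogonal_matrix)
  moreover have "det R * det (M p k) = det (M p k)"
    by (metis RM det_mul det cross_sq gram)
  then have "det R = 1"
    using \<open>det (M p k) \<noteq> 0\<close> by simp
  ultimately have "rotation_matrix R"
    by (simp add: rotation_matrix_def)
  moreover have "R *v p = p'" "R *v k = k'"
    by (metis RM cols matrix_vector_mul_assoc)+
  ultimately show thesis
    using that by blast
qed

section \<open>Transitivity for nonzero energy\<close>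

text \<open>Expanding the second cross product yields exactly the negatives of all terms in
  \<open>v\<close> and \<open>a\<close> contributed by \<open>E *\<^sub>R j'\<close>.\<close>

lemma spin_equivariant:
  fixes R v a j k p E
  assumes "rotation_matrix R"
  defines "j' \<equiv> R *v j + cross3 v (R *v k) + cross3 a (R *v p) + E *\<^sub>R cross3 v a"
  shows "E *\<^sub>R j' + cross3 (R *v p - E *\<^sub>R v) (R *v k + E *\<^sub>R a) = R *v (E *\<^sub>R j + cross3 p k)"
proof -
  \<comment> \<open>The rotated vectors are named so that the coordinate computation treats them as
    arbitrary vectors.\<close>
  define rj rk rp where "rj = R *v j" "rk = R *v k" "rp = R *v p"
  have "R *v (E *\<^sub>R j + cross3 p k) = E *\<^sub>R rj + cross3 rp rk"
    using assms(1) by (simp add: matrix_vector_right_distrib matrix_vector_mult_scaleR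
        cross_rotation_matrix rj_rk_rp_def)
  moreover have "E *\<^sub>R (rj + cross3 v rk + cross3 a rp + E *\<^sub>R cross3 v a)
      + cross3 (rp - E *\<^sub>R v) (rk + E *\<^sub>R a) = E *\<^sub>R rj + cross3 rp rk"
    by (simp add: cross3_simps forall_3)
  ultimately show ?thesis
    by (simp add: j'_def rj_rk_rp_def)
qed

lemma norm_spin:
  assumes "E \<noteq> 0"
  shows "norm (j + inverse E *\<^sub>R cross3 p k) = norm (E *\<^sub>R j + cross3 p k) / \<bar>E\<bar>"
proof -
  have "E *\<^sub>R j + cross3 p k = E *\<^sub>R (j + inverse E *\<^sub>R cross3 p k)"
    using assms by (simp add: scaleR_add_right)
  then show ?thesis
    using assms by simp
qed

text \<open>A rotation aligns the spins; \<open>v\<close> and \<open>a\<close> are then solved from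
  the equations for \<open>p\<close> and \<open>k\<close>. Since \<open>E\<close> is nonzero, equal
  spins with equal \<open>p\<close> and \<open>k\<close> force equal \<open>j\<close>.\<close>

lemma orbit_transitive_nonzero_energy:
  assumes "E \<noteq> 0" "norm (E *\<^sub>R j + cross3 p k) = norm (E *\<^sub>R j' + cross3 p' k')"
  shows "(j', k', p', E) \<in> coadjoint_orbit (j, k, p, E)"
proof -
  obtain R where R: "rotation_matrix R" "R *v (E *\<^sub>R j + cross3 p k) = E *\<^sub>R j' + cross3 p' k'"
    using ex_rotation[OF assms(2)] by blast
  define v where "v = inverse E *\<^sub>R (R *v p - p')"
  define a where "a = inverse E *\<^sub>R (k' - R *v k)"
  have ka: "R *v k + E *\<^sub>R a = k'" and pv: "R *v p - E *\<^sub>R v = p'"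
    using assms(1) by (simp_all add: v_def a_def)
  have "E *\<^sub>R (R *v j + cross3 v (R *v k) + cross3 a (R *v p) + E *\<^sub>R cross3 v a) = E *\<^sub>R j'"
    using spin_equivariant[OF R(1), of E j v k a p] unfolding ka pv R(2) by simp
  then have "R *v j + cross3 v (R *v k) + cross3 a (R *v p) + E *\<^sub>R cross3 v a = j'"
    using assms(1) by simp
  then show ?thesis
    unfolding coadjoint_orbit_eq using R(1) ka pv by blast
qed

section \<open>Transitivity for zero energy\<close>

text \<open>By the double cross product identity, \<open>cross3 x d\<close> divided by
  \<open>x \<bullet> x\<close> is a solution.\<close>

lemma ex_cross_solution:
  fixes d x :: "real^3"
  assumes "x \<noteq> 0" "d \<bullet> x = 0"
  obtains v where "cross3 v x = d"
proof -
  have "cross3 (cross3 x d) x = (x \<bullet> x) *\<^sub>R d - (d \<bullet> x) *\<^sub>R x"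
    by (simp add: cross3_simps forall_3)
  then have "cross3 ((1 / (x \<bullet> x)) *\<^sub>R cross3 x d) x = d"
    using assms by (simp add: cross_mult_left)
  then show thesis
    using that by blast
qed

text \<open>The two terms sweep out the planes orthogonal to \<open>k\<close> and to
  \<open>p\<close>, so it suffices to split \<open>d\<close> into a part orthogonal to
  \<open>p\<close> and a part orthogonal to \<open>k\<close>.\<close>

lemma ex_cross_sum_solution:
  fixes d p k :: "real^3"
  assumes "cross3 p k \<noteq> 0"
  obtains v a where "cross3 v k + cross3 a p = d"
proof -
  define n where "n = cross3 p k"
  \<comment> \<open>\<open>w\<close> is orthogonal to \<open>p\<close> but not to \<open>k\<close>,
    so a multiple of it can absorb the whole component of \<open>d\<close> along
    \<open>k\<close>.\<close>
  define w where "w = cross3 n p"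
  have w: "w \<bullet> p = 0" "w \<bullet> k = n \<bullet> n"
    unfolding w_def n_def by (simp_all add: cross3_simps)
  have nz: "n \<bullet> n \<noteq> 0" "p \<noteq> 0" "k \<noteq> 0"
    using assms by (auto simp: n_def)
  define d2 where "d2 = ((d \<bullet> k) / (n \<bullet> n)) *\<^sub>R w"
  have "d2 \<bullet> p = 0" "(d - d2) \<bullet> k = 0"
    using w nz by (auto simp: d2_def inner_diff_left)
  then obtain v a where "cross3 v k = d - d2" "cross3 a p = d2"
    using ex_cross_solution nz by metis
  then show thesis
    using that[of v a] by simp
qed

lemma orbit_zero_energyI:
  assumes "rotation_matrix R" "R *v k = k'" "R *v p = p'"
    and "cross3 v k' + cross3 a p' = j' - R *v j"
  shows "(j', k', p', 0) \<in> coadjoint_orbit (j, k, p, 0)"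
proof -
  have "j' = R *v j + cross3 v (R *v k) + cross3 a (R *v p) + 0 *\<^sub>R cross3 v a"
    using assms by (simp add: add.assoc)
  then show ?thesis
    unfolding coadjoint_orbit_eq using assms(1-3) by force
qed

text \<open>A vanishing cross product would give equality in Cauchy-Schwarz.\<close>

lemma cross_nonzero_type8:
  assumes "allowed (Type8 p0 k0 \<theta>)" "(j, k, p, E) \<in> locus (Type8 p0 k0 \<theta>)"
  shows "cross3 p k \<noteq> 0"
proof
  assume "cross3 p k = 0"
  then have "(p \<bullet> k)\<^sup>2 = (norm p * norm k)\<^sup>2"
    using norm_cross_dot[of p k] by simp
  then show False
    using type8_inner_less[of p0 k0 \<theta>] assms by (simp add: power_mult_distrib)
qed

section \<open>Each locus is a single orbit\<close>

lemma orbit_transitive: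
  assumes t: "allowed t" and \<alpha>: "\<alpha> \<in> locus t" and \<beta>: "\<beta> \<in> locus t"
  shows "\<beta> \<in> coadjoint_orbit \<alpha>"
proof -
  obtain j k p E where 1: "\<alpha> = (j, k, p, E)"
    by (cases \<alpha>) auto
  obtain j' k' p' E' where 2: "\<beta> = (j', k', p', E')"
    by (cases \<beta>) auto
  note defs = 1 2
  show ?thesis
  proof (cases t)
    case (Type1 E0)
    then show ?thesis
      using t \<alpha> \<beta> by (auto simp: defs intro!: orbit_transitive_nonzero_energy)
  next
    case (Type2 E0 S)
    then show ?thesis
      using t \<alpha> \<beta> by (auto simp: defs norm_spin intro!: orbit_transitive_nonzero_energy)
  next
    case Type3
    obtain R :: "real^3^3" where "rotation_matrix R"
      using ex_rotation[of 0 0] by blast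
    then show ?thesis
      using \<alpha> \<beta> Type3 by (auto simp: defs intro!: orbit_zero_energyI[of R])
  next
    case (Type4 j0)
    then obtain R where "rotation_matrix R" "R *v j = j'"
      using \<alpha> \<beta> ex_rotation[of j j'] by (auto simp: defs)
    then show ?thesis
      using \<alpha> \<beta> Type4 by (auto simp: defs intro!: orbit_zero_energyI[of R])
  next
    case (Type5 k0 h)
    then obtain R where R: "rotation_matrix R" "R *v k = k'"
      using \<alpha> \<beta> ex_rotation[of k k'] by (auto simp: defs)
    \<comment> \<open>Both \<open>j\<close> and \<open>j'\<close> have the prescribed inner product
      with \<open>k\<close> and \<open>k'\<close>, and \<open>R\<close> preserves inner products; so
      the remaining difference lies in the plane reached by \<open>v\<close>.\<close>
    have "k' \<noteq> 0" "(j' - R *v j) \<bullet> k' = 0"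
      using Type5 t \<alpha> \<beta> rotation_inner[OF R(1), of j k] R(2) by (auto simp: defs inner_diff_left)
    then obtain v where "cross3 v k' = j' - R *v j"
      using ex_cross_solution by blast
    then show ?thesis
      using \<alpha> \<beta> R Type5 by (auto simp: defs intro!: orbit_zero_energyI[of R])
  next
    case (Type6 p0 h)
    then obtain R where R: "rotation_matrix R" "R *v p = p'"
      using \<alpha> \<beta> ex_rotation[of p p'] by (auto simp: defs)
    have "p' \<noteq> 0" "(j' - R *v j) \<bullet> p' = 0"
      using Type6 t \<alpha> \<beta> rotation_inner[OF R(1), of j p] R(2) by (auto simp: defs inner_diff_left)
    then obtain a where "cross3 a p' = j' - R *v j"
      using ex_cross_solution by blast
    then show ?thesis
      using \<alpha> \<beta> R Type6 by (auto simp: defs intro!: orbit_zero_energyI[of R _ _ _ _ 0 a])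
  next
    case (Type7 \<sigma> p0 k0 h)
    note L = locus_type7_eq[OF t[unfolded Type7]]
    have A: "E = 0" "k = (\<sigma> * k0 / p0) *\<^sub>R p" "norm p = p0" "j \<bullet> p = h * p0"
      and B: "E' = 0" "k' = (\<sigma> * k0 / p0) *\<^sub>R p'" "norm p' = p0" "j' \<bullet> p' = h * p0"
      using \<alpha> \<beta> unfolding Type7 L defs by auto
    obtain R where R: "rotation_matrix R" "R *v p = p'"
      using A B ex_rotation[of p p'] by auto
    have "p' \<noteq> 0" "(j' - R *v j) \<bullet> p' = 0"
      using t[unfolded Type7] A B rotation_inner[OF R(1), of j p] R(2) by (auto simp: inner_diff_left)
    then obtain a where a: "cross3 a p' = j' - R *v j"
      using ex_cross_solution by blast
    have "R *v k = k'"
      by (simp add: A B R matrix_vector_mult_scaleR)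
    \<comment> \<open>Since \<open>k'\<close> is parallel to \<open>p'\<close>, both translations
      shift \<open>j\<close> within the same plane, and \<open>v = 0\<close> suffices.\<close>
    with a R show ?thesis
      unfolding defs A(1) B(1) by (intro orbit_zero_energyI[of R _ _ _ _ 0 a]) auto
  next
    case (Type8 p0 k0 \<theta>)
    have n: "cross3 p k \<noteq> 0" "cross3 p' k' \<noteq> 0"
      using t \<alpha> \<beta> cross_nonzero_type8 unfolding Type8 defs by blast+
    have "p' \<bullet> p' = p \<bullet> p" "k' \<bullet> k' = k \<bullet> k" "p' \<bullet> k' = p \<bullet> k"
      using \<alpha> \<beta> by (auto simp: Type8 defs dot_square_norm)
    then obtain R where R: "rotation_matrix R" "R *v p = p'" "R *v k = k'"
      using ex_rotation_pair[OF n(1)] by blast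
    obtain v a where "cross3 v k' + cross3 a p' = j' - R *v j"
      using ex_cross_sum_solution[OF n(2)] by blast
    with R show ?thesis
      using \<alpha> \<beta> by (auto simp: Type8 defs intro!: orbit_zero_energyI)
  qed
qed

text \<open>For nonzero energy this is equivariance of the spin. For zero energy the inner products
  of \<open>k\<close> and \<open>p\<close> are preserved by \<open>R\<close>; where \<open>j\<close>
  is constrained through \<open>k\<close> or \<open>p\<close>, its shifts are orthogonal to that
  vector.\<close>

lemma orbit_subset_locus:
  assumes t: "allowed t" and \<alpha>: "\<alpha> \<in> locus t"
  shows "coadjoint_orbit \<alpha> \<subseteq> locus t"
proof
  fix \<beta> assume \<beta>: "\<beta> \<in> coadjoint_orbit \<alpha>"
  obtain j k p E where \<alpha>_eq: "\<alpha> = (j, k, p, E)"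
    by (cases \<alpha>) auto
  obtain R v a where R: "rotation_matrix R"
    and \<beta>_eq: "\<beta> = (R *v j + cross3 v (R *v k) + cross3 a (R *v p) + E *\<^sub>R cross3 v a,
      R *v k + E *\<^sub>R a, R *v p - E *\<^sub>R v, E)"
    using \<beta> unfolding \<alpha>_eq coadjoint_orbit_eq by blast
  note rot = rotation_inner[OF R] rotation_norm[OF R]
  show "\<beta> \<in> locus t"
  proof (cases t)
    case (Type1 E0)
    then show ?thesis
      using \<alpha> t spin_equivariant[OF R] by (simp add: \<alpha>_eq \<beta>_eq)
  next
    case (Type2 E0 S)
    then show ?thesis
      using \<alpha> t spin_equivariant[OF R] by (auto simp: \<alpha>_eq \<beta>_eq norm_spin rot)
  next
    case (Type7 \<sigma> p0 k0 h)
    note L = locus_type7_eq[OF t[unfolded Type7]]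
    show ?thesis
      using \<alpha> unfolding Type7 L
      by (auto simp: \<alpha>_eq \<beta>_eq rot matrix_vector_mult_scaleR inner_add_left dot_cross_self cross_mult_right)
  qed (use \<alpha> in \<open>auto simp: \<alpha>_eq \<beta>_eq rot inner_add_left dot_cross_self\<close>)
qed

theorem coadjoint_orbit_eq_locus:
  assumes "allowed t" "\<alpha> \<in> locus t"
  shows "coadjoint_orbit \<alpha> = locus t"
  using orbit_subset_locus[OF assms] orbit_transitive[OF assms] by blast

section \<open>Representatives and the classification\<close>

text \<open>Only type 8 takes a computation: its \<open>k\<close> has length \<open>k0\<close> and
  makes the angle \<open>\<theta>\<close> with \<open>u\<close>, by orthonormality of
  \<open>u\<close> and \<open>u_perp\<close>.\<close>

lemma representative_in_locus:
  fixes u u_perp :: "real^3"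
  assumes "norm u = 1" "norm u_perp = 1" "u \<bullet> u_perp = 0" "allowed t"
  shows "representative u u_perp t \<in> locus t"
proof -
  have *: "u \<bullet> u = 1" "u_perp \<bullet> u_perp = 1" "u_perp \<bullet> u = 0"
    using assms by (auto simp: norm_eq_1 inner_commute)
  have "norm ((k0 * cos \<theta>) *\<^sub>R u + (k0 * sin \<theta>) *\<^sub>R u_perp) = k0" if "k0 > 0" for k0 \<theta>
  proof -
    have "((k0 * cos \<theta>) *\<^sub>R u + (k0 * sin \<theta>) *\<^sub>R u_perp) \<bullet> ((k0 * cos \<theta>) *\<^sub>R u + (k0 * sin \<theta>) *\<^sub>R u_perp)
        = k0\<^sup>2 * ((cos \<theta>)\<^sup>2 + (sin \<theta>)\<^sup>2)"
      by (simp add: inner_add_left inner_add_right * assms(3) power2_eq_square algebra_simps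
          del: sin_cos_squared_add sin_cos_squared_add2 sin_cos_squared_add3)
    then show ?thesis
      using that by (simp add: norm_eq_sqrt_inner)
  qed
  then show ?thesis
    using assms(1,3,4) by (cases t) (auto simp: * inner_add_right abs_mult)
qed

theorem mainTheorem1:
  fixes u u_perp :: "real^3"
  assumes "norm u = 1" and "norm u_perp = 1" and "u \<bullet> u_perp = 0"
  shows "(\<forall>\<alpha>. \<exists>!t. allowed t \<and> coadjoint_orbit \<alpha> = locus t) \<and>
         (\<forall>t. allowed t \<longrightarrow>
            (\<exists>\<alpha>. locus t = coadjoint_orbit \<alpha>) \<and>
            representative u u_perp t \<in> locus t \<and>
            submanifold_of_dim (orbit_dim t) (locus t))"
proof (intro conjI allI impI)
  fix \<alpha> :: carroll_dual
  obtain t where t: "allowed t" "\<alpha> \<in> locus t"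
    using ex_locus by blast
  then have orbit: "coadjoint_orbit \<alpha> = locus t"
    by (rule coadjoint_orbit_eq_locus)
  show "\<exists>!t. allowed t \<and> coadjoint_orbit \<alpha> = locus t"
  proof (rule ex1I)
    show "allowed t \<and> coadjoint_orbit \<alpha> = locus t"
      using t orbit by blast
    \<comment> \<open>The point \<open>\<alpha>\<close> lies in \<open>locus t\<close>, which equals
      \<open>locus t'\<close>, and distinct allowed loci share no point.\<close>
    show "t' = t" if "allowed t' \<and> coadjoint_orbit \<alpha> = locus t'" for t'
      using that t orbit locus_disjoint[of t' t \<alpha>] by blast
  qed
next
  fix t assume t: "allowed t"
  show rep: "representative u u_perp t \<in> locus t"
    using representative_in_locus[OF assms t] .
  show "\<exists>\<alpha>. locus t = coadjoint_orbit \<alpha>"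
    using coadjoint_orbit_eq_locus[OF t rep] by metis
  show "submanifold_of_dim (orbit_dim t) (locus t)"
    using t by (rule submanifold_locus)
qed

end
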